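(* Let $\mathbb{K}$ be a field, let $n,k\in\mathbb{N}$ be such that $n\geq 2$, $k\geq 3$ and $(n,k)\neq(2,3)$, and let $F\in\mathbb{K}^{\rm cyc}\langle x_1,\dots,x_n\rangle$ be a potential whose homogeneous components satisfy $F_0=\dots=F_{k-1}=0$. Then the completion $\bar A_F$ of the potential algebra $A_F$, and hence also $A_F$ itself, is infinite dimensional over $\mathbb{K}$. Furthermore, if $(n,k)=(2,4)$ or $(n,k)=(3,3)$, then $\bar A_F$ and $A_F$ have at least cubic growth, and in both of these cases cubic growth is possible (that is, it is attained for some such $F$); for all other pairs $(n,k)$ with $n\geq 2$, $k\geq 3$ and $(n,k)\neq(2,3)$, $\bar A_F$ and $A_F$ have exponential growth.
   Context: $\mathbb{K}\langle x_1,\dots,x_n\rangle$ is the free associative unital algebra, graded by $\deg x_i=1$; $F_j$ denotes the homogeneous component of degree $j$ of $F$. $\mathbb{K}^{\rm cyc}\langle x_1,\dots,x_n\rangle$ is the subspace of cyclically invariant elements, i.e. elements fixed by the linear map sending $1\mapsto 1$ and $x_iu\mapsto ux_i$ for every monomial $u$ and every $i$; its elements are called potentials. For each $j$, the noncommutative derivative $\delta_{x_j}$ is the linear map on $\mathbb{K}\langle x_1,\dots,x_n\rangle$ with $\delta_{x_j}(x_jv)=v$ for every monomial $v$, and $\delta_{x_j}(u)=0$ for every monomial $u$ not starting with $x_j$. The potential (Jacobi) algebra of $F$ is $A_F=\mathbb{K}\langle x_1,\dots,x_n\rangle/I$, where $I$ is the two-sided ideal generated by $\delta_{x_1}F,\dots,\delta_{x_n}F$.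 For $j\in\mathbb{Z}_+$, let $J^{(j)}$ be the ideal of $\mathbb{K}\langle x_1,\dots,x_n\rangle$ generated by all monomials of degree strictly bigger than $j$, and put $A_F^{(j)}=\mathbb{K}\langle x_1,\dots,x_n\rangle/(I+J^{(j)})$. The completion of the ideal $I$ is $\bar I=\bigcap_{j}(I+J^{(j)})$, and the completion of $A_F$ is $\bar A_F=\mathbb{K}\langle x_1,\dots,x_n\rangle/\bar I$. Growth: the growth of $\bar A_F$ is that of the function $j\mapsto\dim_{\mathbb K} A_F^{(j)}$; the growth of $A_F$ is that of the function sending $j$ to the dimension of the span in $A_F$ of all monomials of degree at most $j$. Such a function $g$ has at least cubic growth if $g(j)\geq cj^3$ for some $c>0$ and all large $j$; cubic growth if moreover $g(j)\leq Cj^3$ for some $C$ and all large $j$; exponential growth if $g(j)\geq c\lambda^j$ for some $c>0$, $\lambda>1$ and all large $j$ (an exponential upper bound is automatic). *)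

theory Defs
  imports
    "HOL-Library.Cardinality"
    "HOL-Library.Poly_Mapping"
    "HOL-Algebra.Algebraic_Closure_Type"
    "HOL-Algebra.Embedded_Algebras"
    "HOL-Algebra.QuotRing"
begin

section \<open>The free associative algebra\<close>

text \<open>
  Words under concatenation are made an additive monoid, because the convolution product of
  \<^theory>\<open>HOL-Library.Poly_Mapping\<close> is indexed by additive monoids. Thus
  \<open>'x list \<Rightarrow>\<^sub>0 'k\<close> carries the product of the free unital algebra on the variables \<open>'x\<close>
  (one variable for each element of the finite type \<open>'x\<close>).
\<close>

instantiation list :: (type) monoid_add
begin

definition zero_list :: "'a list" where "zero_list = []"

definition plus_list :: "'a list \<Rightarrow> 'a list \<Rightarrow> 'a list" where "plus_list = (@)"

instance by standard (simp_all add: zero_list_def plus_list_def)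

end

type_synonym ('x, 'k) free_alg = "'x list \<Rightarrow>\<^sub>0 'k"

abbreviation FA :: "('x, 'k::field) free_alg ring"
  where "FA \<equiv> ring_of_type_algebra"

definition mon :: "'x list \<Rightarrow> ('x, 'k::field) free_alg"
  where "mon w = Poly_Mapping.single w 1"

definition scalar :: "'k::field \<Rightarrow> ('x, 'k) free_alg"
  where "scalar c = Poly_Mapping.single [] c"

text \<open>The linear map with prescribed values on the basis of monomials.\<close>

definition lin_ext ::
    "('x list \<Rightarrow> ('x, 'k) free_alg) \<Rightarrow> ('x, 'k::field) free_alg \<Rightarrow> ('x, 'k) free_alg"
  where "lin_ext f p =
    (\<Sum>w\<in>Poly_Mapping.keys p. scalar (Poly_Mapping.lookup p w) * f w)"

definition homog_comp :: "nat \<Rightarrow> ('x, 'k::field) free_alg \<Rightarrow> ('x, 'k) free_alg"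
  where "homog_comp j = lin_ext (\<lambda>w. if length w = j then mon w else 0)"

definition cyc_rot :: "('x, 'k::field) free_alg \<Rightarrow> ('x, 'k) free_alg"
  where "cyc_rot = lin_ext (\<lambda>w. case w of [] \<Rightarrow> mon [] | x # u \<Rightarrow> mon (u @ [x]))"

definition potentials :: "('x, 'k::field) free_alg set"
  where "potentials = {F. cyc_rot F = F}"

definition nc_deriv :: "'x \<Rightarrow> ('x, 'k::field) free_alg \<Rightarrow> ('x, 'k) free_alg"
  where "nc_deriv x =
    lin_ext (\<lambda>w. case w of [] \<Rightarrow> 0 | y # v \<Rightarrow> if y = x then mon v else 0)"


section \<open>Potential algebras, their truncations and completions\<close>

text \<open>Ideals of HOL-Algebra are two-sided.\<close>

definition pot_ideal :: "('x, 'k::field) free_alg \<Rightarrow> ('x, 'k) free_alg set"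
  where "pot_ideal F = Idl\<^bsub>FA\<^esub> {nc_deriv x F | x. True}"

definition high_ideal :: "nat \<Rightarrow> ('x, 'k::field) free_alg set"
  where "high_ideal j = Idl\<^bsub>FA\<^esub> {mon w | w. length w > j}"

definition trunc_ideal :: "('x, 'k::field) free_alg \<Rightarrow> nat \<Rightarrow> ('x, 'k) free_alg set"
  where "trunc_ideal F j = pot_ideal F <+>\<^bsub>FA\<^esub> high_ideal j"

definition pot_ideal_completion :: "('x, 'k::field) free_alg \<Rightarrow> ('x, 'k) free_alg set"
  where "pot_ideal_completion F = (\<Inter>j. trunc_ideal F j)"

definition pot_alg :: "('x, 'k::field) free_alg \<Rightarrow> ('x, 'k) free_alg set ring"
  where "pot_alg F = FA Quot pot_ideal F"

definition pot_alg_trunc :: "('x, 'k::field) free_alg \<Rightarrow> nat \<Rightarrow> ('x, 'k) free_alg set ring"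
  where "pot_alg_trunc F j = FA Quot trunc_ideal F j"

definition pot_alg_completion :: "('x, 'k::field) free_alg \<Rightarrow> ('x, 'k) free_alg set ring"
  where "pot_alg_completion F = FA Quot pot_ideal_completion F"

text \<open>
  The copy of the ground field in the quotient by \<open>L\<close>. The theory
  \<^theory>\<open>HOL-Algebra.Embedded_Algebras\<close> measures dimensions over such embedded subfields;
  it is a genuine copy whenever \<open>L\<close> is a proper ideal, as is the case for the three ideals above
  when the component of \<open>F\<close> of degree \<open>1\<close> vanishes.
\<close>

definition ground_field :: "('x, 'k::field) free_alg set \<Rightarrow> ('x, 'k) free_alg set set"
  where "ground_field L = {L +>\<^bsub>FA\<^esub> scalar c | c. True}"

definition infinite_dim_pot_alg :: "('x, 'k::field) free_alg \<Rightarrow> bool"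
  where "infinite_dim_pot_alg F \<longleftrightarrow>
    \<not> ring.finite_dimension (pot_alg F) (ground_field (pot_ideal F)) (carrier (pot_alg F))"

definition infinite_dim_pot_alg_completion :: "('x, 'k::field) free_alg \<Rightarrow> bool"
  where "infinite_dim_pot_alg_completion F \<longleftrightarrow>
    \<not> ring.finite_dimension (pot_alg_completion F) (ground_field (pot_ideal_completion F))
        (carrier (pot_alg_completion F))"


section \<open>Growth\<close>

text \<open>
  \<^const>\<open>ring.Span\<close> takes lists, so the span of a set of monomials is the union of the spans of
  the lists of its elements.
\<close>

definition low_span :: "('x, 'k::field) free_alg \<Rightarrow> nat \<Rightarrow> ('x, 'k) free_alg set set"
  where "low_span F j =
    \<Union>{ring.Span (pot_alg F) (ground_field (pot_ideal F))
          (map (\<lambda>w. pot_ideal F +>\<^bsub>FA\<^esub> mon w) ws) | ws. \<forall>w\<in>set ws. length w \<le> j}"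

definition growth :: "('x, 'k::field) free_alg \<Rightarrow> nat \<Rightarrow> nat"
  where "growth F j = ring.dim (pot_alg F) (ground_field (pot_ideal F)) (low_span F j)"

definition growth_completion :: "('x, 'k::field) free_alg \<Rightarrow> nat \<Rightarrow> nat"
  where "growth_completion F j =
    ring.dim (pot_alg_trunc F j) (ground_field (trunc_ideal F j)) (carrier (pot_alg_trunc F j))"

definition at_least_cubic :: "(nat \<Rightarrow> nat) \<Rightarrow> bool"
  where "at_least_cubic g \<longleftrightarrow>
    (\<exists>c::real. c > 0 \<and> (\<forall>\<^sub>F j in sequentially. real (g j) \<ge> c * real j ^ 3))"

definition cubic :: "(nat \<Rightarrow> nat) \<Rightarrow> bool"
  where "cubic g \<longleftrightarrow> at_least_cubic g \<and>
    (\<exists>C::real. \<forall>\<^sub>F j in sequentially. real (g j) \<le> C * real j ^ 3)"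

text \<open>Only the lower bound is required; growth functions are at most exponential anyway.\<close>

definition exponential :: "(nat \<Rightarrow> nat) \<Rightarrow> bool"
  where "exponential g \<longleftrightarrow>
    (\<exists>(c::real) (l::real). c > 0 \<and> l > 1 \<and> (\<forall>\<^sub>F j in sequentially. real (g j) \<ge> c * l ^ j))"

definition potentials_from :: "nat \<Rightarrow> ('x, 'k::field) free_alg set"
  where "potentials_from k = {F \<in> potentials. \<forall>j<k. homog_comp j F = 0}"

end

(*
  Write r_x for the derivatives of F, I for the ideal they generate and Q_j for the image of I
  in the space of elements of degree at most j. Since F is cyclically invariant,
  sum x r_x = F = sum r_x x, and this syzygy improves the Golod-Shafarevich estimate for dim Q_j.
  For n >= 4, and for n = 3, k >= 4, the estimate without the syzygy already forces exponential
  growth.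

  In the remaining cases F is compared with a homogeneous potential G of degree k whose algebra
  is spanned by an explicit set of normal words: the cyclic sum of x^(k-2) y^2 for n = 2 and
  k = 4, 5, and xyz - xzy, cyclically summed, for n = 3 and k = 3. The generic deformation
  (1 - t) F + t G over K(t) specializes to F at t = 0 and to G at t = 1. Linear independence lifts
  from a specialization to K(t), so dim Q_j can only grow from F to the deformation, whereas the
  normal words of G still span modulo the ideal of the deformation. Inserting them into the
  estimate shows that the algebra of F grows at least as fast as the number of normal words,
  which is cubic for (2,4) and (3,3) and exponential for (2,5); for (2,4) and (3,3) the potential
  G itself attains it.
*)
theory Submission
  imports Defs "HOL-Computational_Algebra.Polynomial_Factorial" "HOL-Library.Sublist"
begin

section \<open>Linear algebra in the free algebra\<close>

text \<open>Let a_j be the codimension of Q_j. The estimate bounds a_j from below by 1 + n a_(j-1)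
  minus the cost of the new multiples r_x c, where c runs over a spanning set modulo Q_m and m = j -
  (k - 1). The obstacle is this minus sign: a lower bound for a_j needs an upper bound in degree m
  for the same potential, and lower bounds alone do not propagate. For n >= 4, and for n = 3 with k
  >= 4, the ratio a_(j+1) >= 2 a_j keeps the cost under control. Otherwise one potential has to
  carry both bounds, and the deformation does: its spanning set comes from G, and dim Q_j of F is at
  most that of the deformation. The parameter is transcendental because a finite field K may contain
  no generic value. The syzygy saves something only for elements x0 e of the spanning set. The
  forbidden words of G are therefore chosen not to begin with x0, so that prepending x0 keeps a word
  normal. As F need not be homogeneous, all counts are cumulative in the degree; the summand 1 in
  the recursions stands for the empty word.\<close>

definition scl :: "'k::field \<Rightarrow> ('x, 'k) free_alg \<Rightarrow> ('x, 'k) free_alg"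
  where "scl c p = scalar c * p"

lemma lookup_scl [simp]: "Poly_Mapping.lookup (scl c p) w = c * Poly_Mapping.lookup p w"
proof -
  have "scl c p = Poly_Mapping.map ((*) c) p"
    by (simp add: scl_def scalar_def mult_map_scale_conv_mult zero_list_def)
  then show ?thesis
    by (simp add: Poly_Mapping.map.rep_eq when_def)
qed

lemma lookup_mon: "Poly_Mapping.lookup (mon u) w = (if w = u then 1 else 0)"
  by (auto simp: mon_def lookup_single when_def)

lemma mon_eq_iff [simp]: "mon u = (mon v :: ('x, 'k::field) free_alg) \<longleftrightarrow> u = v"
  by (metis lookup_mon zero_neq_one)

lemma inj_mon: "inj_on (mon :: 'x list \<Rightarrow> ('x, 'k::field) free_alg) A"
  by (simp add: inj_on_def)

global_interpretation FA: vector_space "scl :: 'k::field \<Rightarrow> ('x, 'k) free_alg \<Rightarrow> ('x, 'k) free_alg"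
  by unfold_locales (auto intro!: poly_mapping_eqI simp: lookup_add algebra_simps)

lemma scalar_commute: "p * scalar c = scalar c * p"
proof (rule poly_mapping_eqI)
  fix w
  have inner: "(\<Sum>q. ((c when [] = q) when w = l + q)) = (c when w = l)" for l :: "'a list"
  proof -
    have "(\<lambda>q. ((c when [] = q) when w = l + q)) = (\<lambda>q. (c when w = l) when [] = q)"
      by (auto simp: when_def plus_list_def)
    then show ?thesis by (simp only: Sum_any_when_equal')
  qed
  have "Poly_Mapping.lookup (p * scalar c) w =
     (\<Sum>l. Poly_Mapping.lookup p l * (\<Sum>q. ((c when [] = q) when w = l + q)))"
    by (simp only: lookup_mult scalar_def lookup_single)
  also have "\<dots> = (\<Sum>l. (Poly_Mapping.lookup p l * c) when w = l)"
    by (simp only: inner mult_when)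
  also have "\<dots> = Poly_Mapping.lookup p w * c"
    by simp
  finally show "Poly_Mapping.lookup (p * scalar c) w = Poly_Mapping.lookup (scalar c * p) w"
    using lookup_scl[of c p w] by (simp add: scl_def mult.commute)
qed

lemma scl_mult_left: "scl c p * q = scl c (p * q)"
  by (simp add: scl_def mult.assoc)

lemma scl_mult_right: "p * scl c q = scl c (p * q)"
  by (simp add: scl_def mult.assoc[symmetric] scalar_commute)

lemma mon_mult: "mon u * mon v = mon (u @ v)"
  by (simp add: mon_def mult_single plus_list_def)

lemma mon_Nil: "mon [] = 1"
  by (simp add: mon_def flip: zero_list_def)

lemma FA_expand: "p = (\<Sum>w\<in>Poly_Mapping.keys p. scl (Poly_Mapping.lookup p w) (mon w))"
  by (rule poly_mapping_eqI)
    (auto simp: lookup_sum lookup_mon in_keys_iff if_distrib sum.delta cong: if_cong)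

lemma FA_induct [case_names zero mon scl add]:
  assumes "P 0" and "\<And>w. P (mon w)" and "\<And>c p. P p \<Longrightarrow> P (scl c p)"
    and "\<And>p q. P p \<Longrightarrow> P q \<Longrightarrow> P (p + q)"
  shows "P p"
proof -
  have "P (\<Sum>w\<in>A. scl (Poly_Mapping.lookup p w) (mon w))" if "finite A" for A
    using that by (induction A) (auto intro: assms)
  then show ?thesis by (subst FA_expand) auto
qed

lemma lookup_lin_ext:
  assumes "finite A" "Poly_Mapping.keys p \<subseteq> A"
  shows "Poly_Mapping.lookup (lin_ext f p) v =
    (\<Sum>w\<in>A. Poly_Mapping.lookup p w * Poly_Mapping.lookup (f w) v)"
proof -
  have "Poly_Mapping.lookup (lin_ext f p) v =
    (\<Sum>w\<in>Poly_Mapping.keys p. Poly_Mapping.lookup p w * Poly_Mapping.lookup (f w) v)"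
    by (simp add: lin_ext_def lookup_sum flip: scl_def)
  also have "\<dots> = (\<Sum>w\<in>A. Poly_Mapping.lookup p w * Poly_Mapping.lookup (f w) v)"
    by (rule sum.mono_neutral_left) (use assms in \<open>auto simp: in_keys_iff\<close>)
  finally show ?thesis .
qed

lemma lin_ext_mon [simp]: "lin_ext f (mon w) = f w"
  by (simp add: lin_ext_def mon_def scalar_def flip: zero_list_def)

lemma lin_ext_zero [simp]: "lin_ext f 0 = 0"
  by (simp add: lin_ext_def)

lemma lin_ext_add [simp]: "lin_ext f (p + q) = lin_ext f p + lin_ext f q"
proof (rule poly_mapping_eqI)
  fix v
  define A where "A = Poly_Mapping.keys p \<union> Poly_Mapping.keys q"
  have A: "finite A" "Poly_Mapping.keys p \<subseteq> A" "Poly_Mapping.keys q \<subseteq> A"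
    "Poly_Mapping.keys (p + q) \<subseteq> A"
    unfolding A_def by (auto dest: subsetD[OF keys_add])
  show "Poly_Mapping.lookup (lin_ext f (p + q)) v =
    Poly_Mapping.lookup (lin_ext f p + lin_ext f q) v"
    by (simp add: lookup_add lookup_lin_ext[OF A(1)] A ring_distribs sum.distrib)
qed

lemma lin_ext_scl [simp]: "lin_ext f (scl c p) = scl c (lin_ext f p)"
proof (rule poly_mapping_eqI)
  fix v
  have "Poly_Mapping.keys (scl c p) \<subseteq> Poly_Mapping.keys p"
    by (auto simp: in_keys_iff)
  then show "Poly_Mapping.lookup (lin_ext f (scl c p)) v = Poly_Mapping.lookup (scl c (lin_ext f p)) v"
    by (simp add: lookup_lin_ext[of "Poly_Mapping.keys p"] sum_distrib_left mult.assoc)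
qed

lemma lookup_mon_mult:
  "Poly_Mapping.lookup (mon u * p) w =
    (if take (length u) w = u then Poly_Mapping.lookup p (drop (length u) w) else 0)"
proof (induction p rule: FA_induct)
  case (mon v)
  have "w = u @ v \<longleftrightarrow> take (length u) w = u \<and> drop (length u) w = v"
    by (metis append_eq_conv_conj)
  then show ?case by (auto simp: mon_mult lookup_mon)
qed (auto simp: scl_mult_right ring_distribs lookup_add)

lemma lookup_mult_mon:
  "Poly_Mapping.lookup (p * mon u) w =
    (if drop (length w - length u) w = u then Poly_Mapping.lookup p (take (length w - length u) w) else 0)"
proof (induction p rule: FA_induct)
  case (mon v)
  have "w = v @ u \<longleftrightarrow> drop (length w - length u) w = u \<and> take (length w - length u) w = v"
    by (metis append_eq_conv_conj append_take_drop_id diff_diff_cancel length_append length_drop add_diff_cancel_right')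
  then show ?case by (auto simp: mon_mult lookup_mon)
qed (auto simp: scl_mult_left ring_distribs lookup_add)

section \<open>Truncation by degree, and the spaces of elements of low or of high degree\<close>

definition trunc :: "nat \<Rightarrow> ('x, 'k::field) free_alg \<Rightarrow> ('x, 'k) free_alg"
  where "trunc j = lin_ext (\<lambda>w. if length w \<le> j then mon w else 0)"

lemma lookup_trunc:
  "Poly_Mapping.lookup (trunc j p) w = (if length w \<le> j then Poly_Mapping.lookup p w else 0)"
  unfolding trunc_def
  by (induction p rule: FA_induct) (auto simp: lookup_add lookup_mon)

lemma trunc_add [simp]: "trunc j (p + q) = trunc j p + trunc j q"
  and trunc_scl [simp]: "trunc j (scl c p) = scl c (trunc j p)"
  and trunc_zero [simp]: "trunc j 0 = 0"
  by (simp_all add: trunc_def)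

lemma trunc_mon: "trunc j (mon w) = (if length w \<le> j then mon w else 0)"
  by (simp add: trunc_def)

lemma trunc_diff [simp]: "trunc j (p - q) = trunc j p - trunc j q"
  by (rule poly_mapping_eqI) (simp add: lookup_trunc lookup_minus)

lemma trunc_sum [simp]: "trunc j (sum f A) = (\<Sum>a\<in>A. trunc j (f a))"
  by (induction A rule: infinite_finite_induct) auto

lemma trunc_var_mult: "trunc (Suc j) (mon [x] * p) = mon [x] * trunc j p"
  by (rule poly_mapping_eqI) (auto simp: lookup_trunc lookup_mon_mult)

lemma trunc_trunc [simp]: "i \<le> j \<Longrightarrow> trunc i (trunc j p) = trunc i p"
  by (rule poly_mapping_eqI) (auto simp: lookup_trunc)

definition low :: "nat \<Rightarrow> ('x, 'k::field) free_alg set"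
  where "low j = {p. \<forall>w. length w > j \<longrightarrow> Poly_Mapping.lookup p w = 0}"

lemma trunc_in_low: "trunc j p \<in> low j"
  by (auto simp: low_def lookup_trunc)

lemma trunc_low: "p \<in> low j \<Longrightarrow> trunc j p = p"
  by (rule poly_mapping_eqI) (auto simp: low_def lookup_trunc)

lemma subspace_low: "FA.subspace (low j)"
  by (auto simp: FA.subspace_def low_def lookup_add)

definition deg_ge :: "nat \<Rightarrow> ('x, 'k::field) free_alg set"
  where "deg_ge d = {p. \<forall>w. length w < d \<longrightarrow> Poly_Mapping.lookup p w = 0}"

lemma subspace_deg_ge: "FA.subspace (deg_ge d)"
  by (auto simp: FA.subspace_def deg_ge_def lookup_add)

text \<open>Every monomial of \<open>p\<close> contributes at least \<open>d\<close> letters, so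
  terms of \<open>q\<close> beyond degree \<open>m\<close> end up above degree \<open>m + d\<close>.
  This is the lag in the recursion: multiples of a relation up to degree \<open>m + d\<close> depend
  only on cofactors up to degree \<open>m\<close>.\<close>

lemma trunc_mult_deg_ge:
  assumes "p \<in> deg_ge d" "j = m + d"
  shows "trunc j (p * q) = trunc j (p * trunc m q)"
proof -
  have mon: "trunc j (scl c (mon u) * q) = trunc j (scl c (mon u) * trunc m q)"
    if "c \<noteq> 0 \<Longrightarrow> length u \<ge> d" for c u
  proof (cases "c = 0")
    case False
    then show ?thesis using that assms(2)
      by (intro poly_mapping_eqI) (auto simp: lookup_trunc lookup_mon_mult scl_mult_left)
  qed (simp add: FA.scale_zero_left)
  have u: "length u \<ge> d" if "Poly_Mapping.lookup p u \<noteq> 0" for u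
    using that assms(1) by (force simp: deg_ge_def)
  have "trunc j (p * q) = trunc j ((\<Sum>u\<in>Poly_Mapping.keys p. scl (Poly_Mapping.lookup p u) (mon u)) * q)"
    by (subst FA_expand[of p]) simp
  also have "\<dots> = (\<Sum>u\<in>Poly_Mapping.keys p. trunc j (scl (Poly_Mapping.lookup p u) (mon u) * q))"
    by (simp add: sum_distrib_right)
  also have "\<dots> = (\<Sum>u\<in>Poly_Mapping.keys p. trunc j (scl (Poly_Mapping.lookup p u) (mon u) * trunc m q))"
    by (intro sum.cong refl mon u)
  also have "\<dots> = trunc j ((\<Sum>u\<in>Poly_Mapping.keys p. scl (Poly_Mapping.lookup p u) (mon u)) * trunc m q)"
    by (simp add: sum_distrib_right)
  also have "\<dots> = trunc j (p * trunc m q)"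
    by (subst (2) FA_expand[of p]) simp
  finally show ?thesis .
qed

lemma independent_mon: "FA.independent (mon ` A :: ('x, 'k::field) free_alg set)"
proof -
  have inj: "inj (mon :: 'x list \<Rightarrow> ('x, 'k) free_alg)"
    by (rule inj_mon)
  show ?thesis
    unfolding FA.independent_explicit_finite_subsets
  proof (intro allI impI ballI)
    fix S :: "('x, 'k) free_alg set" and u v
    assume S: "S \<subseteq> mon ` A" "finite S" "(\<Sum>v\<in>S. scl (u v) v) = 0" "v \<in> S"
    obtain w where w: "v = mon w" using S by auto
    have "0 = Poly_Mapping.lookup (\<Sum>v\<in>S. scl (u v) v) w" using S by simp
    also have "\<dots> = (\<Sum>s\<in>S. if s = v then u v else 0)"
      unfolding lookup_sum
    proof (intro sum.cong refl)
      fix s assume "s \<in> S"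
      then obtain w' where "s = mon w'" using S by auto
      then show "Poly_Mapping.lookup (scl (u s) s) w = (if s = v then u v else 0)"
        using w inj by (auto simp: lookup_mon inj_def)
    qed
    also have "\<dots> = u v" using S by simp
    finally show "u v = 0" by simp
  qed
qed

lemma low_eq_span: "low j = FA.span (mon ` {w. length w \<le> j})"
proof (intro equalityI subsetI)
  fix p :: "('x, 'k::field) free_alg" assume p: "p \<in> low j"
  have "(\<Sum>w\<in>Poly_Mapping.keys p. scl (Poly_Mapping.lookup p w) (mon w)) \<in> FA.span (mon ` {w. length w \<le> j})"
    by (intro FA.span_sum FA.span_scale FA.span_base)
      (use p in \<open>auto simp: low_def in_keys_iff not_le[symmetric]\<close>)
  then show "p \<in> FA.span (mon ` {w. length w \<le> j})" by (subst FA_expand)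
next
  fix p :: "('x, 'k::field) free_alg" assume "p \<in> FA.span (mon ` {w. length w \<le> j})"
  moreover have "FA.span (mon ` {w. length w \<le> j}) \<subseteq> low j"
    by (intro FA.span_minimal subspace_low) (auto simp: low_def lookup_mon)
  ultimately show "p \<in> low j" by auto
qed

definition words_le :: "'x itself \<Rightarrow> nat \<Rightarrow> nat"
  where "words_le _ j = card {w :: 'x list. length w \<le> j}"

lemma finite_words: "finite {w :: 'x::finite list. length w \<le> j}"
  using finite_lists_length_le[of "UNIV :: 'x set" j] by simp

lemma words_le_0: "words_le TYPE('x::finite) 0 = 1"
  by (simp add: words_le_def)

lemma words_le_Suc: "words_le TYPE('x::finite) (Suc j) = 1 + CARD('x) * words_le TYPE('x) j"
proof -
  let ?W = "{w :: 'x list. length w \<le> j}"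
  have "{w :: 'x list. length w \<le> Suc j} = insert [] ((\<lambda>(x, w). x # w) ` (UNIV \<times> ?W))"
  proof (intro equalityI subsetI)
    fix w :: "'x list" assume "w \<in> {w. length w \<le> Suc j}"
    then show "w \<in> insert [] ((\<lambda>(x, w). x # w) ` (UNIV \<times> ?W))"
      by (cases w) (auto simp: image_iff)
  qed auto
  moreover have "card ((\<lambda>(x, w). x # w) ` (UNIV \<times> ?W)) = CARD('x) * card ?W"
    by (subst card_image) (auto simp: inj_on_def card_cartesian_product)
  ultimately show ?thesis
    by (auto simp: words_le_def card_insert_if finite_words)
qed

lemma finite_dim_low_card:
  assumes "FA.independent S" "S \<subseteq> (low j :: ('x::finite, 'k::field) free_alg set)"
  shows "finite S" "card S \<le> words_le TYPE('x) j"
proof -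
  have c: "card ((mon :: _ \<Rightarrow> ('x, 'k) free_alg) ` {w. length w \<le> j}) = words_le TYPE('x) j"
    unfolding words_le_def by (rule card_image[OF inj_mon])
  from FA.independent_span_bound[OF finite_imageI[OF finite_words] assms(1), of mon j]
  show "finite S" "card S \<le> words_le TYPE('x) j"
    using assms(2) c by (simp_all add: low_eq_span)
qed

lemma dim_low: "FA.dim (low j :: ('x::finite, 'k::field) free_alg set) = words_le TYPE('x) j"
  unfolding low_eq_span FA.dim_span words_le_def
  by (simp add: FA.dim_eq_card_independent[OF independent_mon] card_image[OF inj_mon])

lemma dim_le_words_le:
  assumes "V \<subseteq> (low j :: ('x::finite, 'k::field) free_alg set)"
  shows "FA.dim V \<le> words_le TYPE('x) j"
  using assms FA.basis_exists[of V] finite_dim_low_card by (metis subset_trans)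

section \<open>A Golod--Shafarevich bound for potential relations\<close>

text \<open>Given as a span of products, so that bases and dimensions are available at once, over
  the ground field as well as over its function field. For the derivatives of a potential it agrees
  with \<open>pot_ideal\<close>, by \<open>pot_ideal_subset\<close> and
  \<open>rel_ideal_subset_pot_ideal\<close>.\<close>

definition rel_ideal :: "('x \<Rightarrow> ('x, 'k::field) free_alg) \<Rightarrow> ('x, 'k) free_alg set"
  where "rel_ideal r = FA.span {mon u * r x * mon v | u x v. True}"

definition rel_trunc :: "('x \<Rightarrow> ('x, 'k::field) free_alg) \<Rightarrow> nat \<Rightarrow> ('x, 'k) free_alg set"
  where "rel_trunc r j = trunc j ` rel_ideal r"

lemma linear_trunc: "Vector_Spaces.linear scl scl (trunc j)"
  by unfold_locales auto

lemma linear_mult_left: "Vector_Spaces.linear scl scl (\<lambda>q. p * q)"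
  by unfold_locales (auto simp: ring_distribs scl_mult_right)

lemma linear_mult_right: "Vector_Spaces.linear scl scl (\<lambda>q. q * p)"
  by unfold_locales (auto simp: ring_distribs scl_mult_left)

lemma subspace_rel_ideal: "FA.subspace (rel_ideal r)"
  by (simp add: rel_ideal_def)

lemma rel_ideal_gen: "mon u * r x * mon v \<in> rel_ideal r"
  unfolding rel_ideal_def by (rule FA.span_base) blast

lemma span_linear_image:
  assumes "Vector_Spaces.linear scl scl f" "f ` S \<subseteq> V" "FA.subspace V" "p \<in> FA.span S"
  shows "f p \<in> V"
proof -
  interpret f: Vector_Spaces.linear scl scl f by fact
  from f.subspace_vimage[OF assms(3)] have "FA.span S \<subseteq> f -` V"
    by (rule FA.span_minimal[rotated]) (use assms(2) in auto)
  with assms(4) show ?thesis by auto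
qed

lemma rel_ideal_mult_left:
  assumes "p \<in> rel_ideal r"
  shows "q * p \<in> rel_ideal r"
proof (induction q rule: FA_induct)
  case (mon w)
  show ?case
    by (rule span_linear_image[OF linear_mult_left _ subspace_rel_ideal assms[unfolded rel_ideal_def]])
      (auto simp: mult.assoc[symmetric] mon_mult rel_ideal_gen)
qed (auto simp: scl_mult_left ring_distribs intro: FA.subspace_0 FA.subspace_add FA.subspace_scale subspace_rel_ideal)

lemma rel_ideal_mult_right:
  assumes "p \<in> rel_ideal r"
  shows "p * q \<in> rel_ideal r"
proof (induction q rule: FA_induct)
  case (mon w)
  have "mon u * r x * mon v * mon w \<in> rel_ideal r" for u x v
    using rel_ideal_gen[of u r x "v @ w"] by (simp add: mult.assoc mon_mult)
  then show ?case
    by (intro span_linear_image[OF linear_mult_right _ subspace_rel_ideal assms[unfolded rel_ideal_def]])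
      auto
qed (auto simp: scl_mult_right ring_distribs intro: FA.subspace_0 FA.subspace_add FA.subspace_scale subspace_rel_ideal)

lemma rel_in_rel_ideal: "r x \<in> rel_ideal r"
  using rel_ideal_gen[of "[]" r x "[]"] by (simp add: mon_Nil)

lemma subspace_rel_trunc: "FA.subspace (rel_trunc r j)"
proof -
  interpret t: Vector_Spaces.linear scl scl "trunc j" by (rule linear_trunc)
  show ?thesis unfolding rel_trunc_def by (intro t.subspace_image subspace_rel_ideal)
qed

lemma rel_trunc_span: "rel_trunc r j = FA.span {trunc j (mon u * r x * mon v) | u x v. True}"
proof -
  interpret t: Vector_Spaces.linear scl scl "trunc j" by (rule linear_trunc)
  have "trunc j ` {mon u * r x * mon v | u x v. True} = {trunc j (mon u * r x * mon v) | u x v. True}"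
    by blast
  then show ?thesis
    unfolding rel_trunc_def rel_ideal_def by (simp add: t.span_image[symmetric])
qed

lemma rel_trunc_low: "rel_trunc r j \<subseteq> low j"
  by (auto simp: rel_trunc_def trunc_in_low)

lemma deg_ge_Suc_decompose:
  fixes p :: "('x::finite, 'k::field) free_alg"
  assumes "p \<in> deg_ge (Suc d)"
  shows "\<exists>s. p = (\<Sum>y\<in>UNIV. mon [y] * s y)"
proof -
  have *: "\<exists>s. q = (\<Sum>y\<in>UNIV. mon [y] * s y)"
    if "finite A" "[] \<notin> A" "q = (\<Sum>w\<in>A. scl (c w) (mon w))" for A q and c :: "'x list \<Rightarrow> 'k"
    using that
  proof (induction A arbitrary: q)
    case empty
    then show ?case by (intro exI[of _ "\<lambda>_. 0"]) simp
  next
    case (insert w A)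
    from insert.prems obtain x v where w: "w = x # v" by (cases w) auto
    from insert.IH[OF _ refl] insert.prems obtain s where
      s: "(\<Sum>w\<in>A. scl (c w) (mon w)) = (\<Sum>y\<in>UNIV. mon [y] * s y)" by auto
    have "(\<Sum>y\<in>UNIV. mon [y] * (if y = x then scl (c w) (mon v) else 0)) = scl (c w) (mon w)"
      by (simp add: if_distrib scl_mult_right mon_mult w cong: if_cong)
    then have "q = (\<Sum>y\<in>UNIV. mon [y] * ((if y = x then scl (c w) (mon v) else 0) + s y))"
      using insert s by (simp add: ring_distribs sum.distrib)
    then show ?case by (intro exI[of _ "\<lambda>y. (if y = x then scl (c w) (mon v) else 0) + s y"])
  qed
  have "[] \<notin> Poly_Mapping.keys p" using assms by (auto simp: deg_ge_def in_keys_iff)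
  from *[OF finite_keys this FA_expand] show ?thesis .
qed

text \<open>Isolates what the estimate uses about the derivatives of a potential, so that it applies
  to deformed relations without exhibiting a potential for them. For a potential starting in degree
  k, \<open>d\<close> is k - 1.\<close>

locale potential_relations =
  fixes r :: "'x::finite \<Rightarrow> ('x, 'k::field) free_alg" and d :: nat
  assumes cyclic: "(\<Sum>x\<in>UNIV. mon [x] * r x) = (\<Sum>x\<in>UNIV. r x * mon [x])"
    and deg: "r x \<in> deg_ge d"
    and d_pos: "d > 0"
begin

lemma rel_trunc_eq_0:
  assumes "j < d"
  shows "rel_trunc r j = {0}"
proof -
  have "r x * p \<in> deg_ge d" for x p
  proof (induction p rule: FA_induct)
    case (mon w)
    show ?case using deg by (auto simp: deg_ge_def lookup_mult_mon)
  qed (auto simp: scl_mult_right ring_distribs intro: FA.subspace_0 FA.subspace_add FA.subspace_scale subspace_deg_ge)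
  then have "mon u * (r x * p) \<in> deg_ge d" for u x p
    by (auto simp: deg_ge_def lookup_mon_mult)
  then have "trunc j (mon u * r x * mon v) = 0" for u x v
    using assms by (intro poly_mapping_eqI) (auto simp: lookup_trunc deg_ge_def mult.assoc)
  then have "{trunc j (mon u * r x * mon v) | u x v. True} \<subseteq> {0}" by auto
  then have "rel_trunc r j \<subseteq> {0}"
    unfolding rel_trunc_span by (rule FA.span_minimal) simp
  then show ?thesis using FA.subspace_0[OF subspace_rel_trunc] by blast
qed

text \<open>
  The right module \<open>I / \<Sum>\<^sub>x x I\<close> is generated by the \<open>r\<^sub>x\<close> and annihilated by \<open>I\<close>, so that only
  multiples \<open>r\<^sub>x c\<close> with \<open>c\<close> from a spanning set modulo \<open>I\<close> are needed. The syzygy \<open>\<Sum>\<^sub>x x r\<^sub>x = \<Sum>\<^sub>x r\<^sub>x x\<close> makes the multiples \<open>r\<^sub>x\<^sub>0 x\<^sub>0 e\<close> redundant.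
\<close>

theorem dim_rel_trunc_le:
  assumes j: "j = m + d" and fin: "finite C" "finite E"
    and sp: "low m \<subseteq> FA.span (C \<union> (\<lambda>e. mon [x0] * e) ` E \<union> rel_trunc r m)"
    and E: "\<And>e x. e \<in> E \<Longrightarrow> mon [x] * e \<in> low m"
  shows "FA.dim (rel_trunc r j) \<le>
    CARD('x) * FA.dim (rel_trunc r (j - 1)) + CARD('x) * card C + (CARD('x) - 1) * card E"
proof -
  obtain i where i: "j = Suc i" using d_pos j by (metis add_is_0 gr0_conv_Suc not_gr0)
  obtain B where B: "B \<subseteq> rel_trunc r i" "FA.independent B" "rel_trunc r i \<subseteq> FA.span B"
    "card B = FA.dim (rel_trunc r i)" using FA.basis_exists by blast
  have finB: "finite B" using finite_dim_low_card(1)[OF B(2)] B(1) rel_trunc_low by blast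
  define T1 where "T1 = (\<lambda>(x, b). mon [x] * b) ` (UNIV \<times> B)"
  define T2 where "T2 = (\<lambda>(x, c). trunc j (r x * c)) ` (UNIV \<times> C)"
  define T3 where "T3 = (\<lambda>(x, e). trunc j (r x * (mon [x0] * e))) ` ((UNIV - {x0}) \<times> E)"
  define P where "P = FA.span (T1 \<union> T2 \<union> T3)"
  have sub: "FA.subspace P" by (simp add: P_def)
  have g2: "trunc j (r x * c) \<in> P" if "c \<in> C" for x c
    unfolding P_def by (rule FA.span_base) (use that in \<open>auto simp: T2_def\<close>)
  have g3: "trunc j (r x * (mon [x0] * e)) \<in> P" if "e \<in> E" "x \<noteq> x0" for x e
    unfolding P_def by (rule FA.span_base) (use that in \<open>auto simp: T3_def\<close>)
  note closed = FA.subspace_0[OF sub] FA.subspace_add[OF sub] FA.subspace_diff[OF sub]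
    FA.subspace_sum[OF sub]
  have s1: "trunc j (mon [y] * p) \<in> P" if "p \<in> rel_ideal r" for y p
  proof -
    have "trunc i p \<in> FA.span B" using B(3) that by (auto simp: rel_trunc_def)
    then have "mon [y] * trunc i p \<in> P"
      by (rule span_linear_image[OF linear_mult_left _ sub, rotated])
        (auto simp: P_def T1_def intro!: FA.span_base)
    then show ?thesis by (simp add: i trunc_var_mult)
  qed
  have lin: "Vector_Spaces.linear scl scl (\<lambda>c. trunc j (r x * c))" for x
    by unfold_locales (auto simp: ring_distribs scl_mult_right)
  \<comment> \<open>A relation has no constant term, so it is a sum of terms
    \<open>mon [y] * s y\<close>. Its product with an element \<open>p\<close> of the ideal is then
    a sum of letters times elements \<open>s y * p\<close> of the ideal, which \<open>s1\<close>
    covers.\<close>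
  have s2: "trunc j (r x * q) \<in> P" if q: "q \<in> rel_trunc r m" for x q
  proof -
    obtain p where p: "p \<in> rel_ideal r" "q = trunc m p" using q by (auto simp: rel_trunc_def)
    obtain d' where "d = Suc d'" using d_pos by (cases d) auto
    then obtain s where s: "r x = (\<Sum>y\<in>UNIV. mon [y] * s y)"
      using deg_ge_Suc_decompose[of "r x"] deg by blast
    have "trunc j (r x * q) = trunc j (r x * p)"
      using trunc_mult_deg_ge[OF deg j] p by simp
    also have "\<dots> = (\<Sum>y\<in>UNIV. trunc j (mon [y] * (s y * p)))"
      by (simp add: s sum_distrib_right mult.assoc)
    also have "\<dots> \<in> P" by (intro closed s1 rel_ideal_mult_left p)
    finally show ?thesis .
  qed
  \<comment> \<open>The letters other than \<open>x0\<close> come before \<open>x0\<close>: the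
    syzygy rewrites \<open>r x0 * (mon [x0] * e)\<close> through the multiples
    \<open>r y * (mon [y] * e)\<close> with \<open>y\<close> different from \<open>x0\<close>, whose
    cofactors \<open>E\<close> keeps inside \<open>low m\<close>.\<close>
  have s3: "trunc j (r x * q) \<in> P" if "x \<noteq> x0" "q \<in> low m" for x q
  proof (rule span_linear_image[OF lin _ sub])
    show "q \<in> FA.span (C \<union> (\<lambda>e. mon [x0] * e) ` E \<union> rel_trunc r m)" using sp that by blast
    show "(\<lambda>c. trunc j (r x * c)) ` (C \<union> (\<lambda>e. mon [x0] * e) ` E \<union> rel_trunc r m) \<subseteq> P"
      using s2 g2 g3 that(1) by auto
  qed
  have s4: "trunc j (r x0 * (mon [x0] * e)) \<in> P" if "e \<in> E" for e
  proof -
    have "r x0 * (mon [x0] * e) + (\<Sum>y\<in>UNIV - {x0}. r y * (mon [y] * e)) =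
        (\<Sum>y\<in>UNIV. r y * mon [y]) * e"
      by (simp add: sum.remove[of UNIV x0] ring_distribs sum_distrib_right mult.assoc)
    also have "\<dots> = (\<Sum>y\<in>UNIV. mon [y] * (r y * e))"
      by (simp flip: cyclic add: sum_distrib_right mult.assoc)
    finally have "r x0 * (mon [x0] * e) =
      (\<Sum>y\<in>UNIV. mon [y] * (r y * e)) - (\<Sum>y\<in>UNIV - {x0}. r y * (mon [y] * e))"
      by (simp add: algebra_simps)
    then have "trunc j (r x0 * (mon [x0] * e)) =
      (\<Sum>y\<in>UNIV. trunc j (mon [y] * (r y * e))) - (\<Sum>y\<in>UNIV - {x0}. trunc j (r y * (mon [y] * e)))"
      by simp
    also have "\<dots> \<in> P"
      by (intro closed s1 rel_ideal_mult_right rel_in_rel_ideal s3 E that) auto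
    finally show ?thesis .
  qed
  have s5: "trunc j (r x * q) \<in> P" for x q
  proof -
    have "trunc j (r x * trunc m q) \<in> P"
    proof (rule span_linear_image[OF lin _ sub])
      show "trunc m q \<in> FA.span (C \<union> (\<lambda>e. mon [x0] * e) ` E \<union> rel_trunc r m)"
        using sp trunc_in_low by blast
      show "(\<lambda>c. trunc j (r x * c)) ` (C \<union> (\<lambda>e. mon [x0] * e) ` E \<union> rel_trunc r m) \<subseteq> P"
        using s2 s4 g2 g3 by (cases "x = x0") auto
    qed
    then show ?thesis using trunc_mult_deg_ge[OF deg j] by simp
  qed
  have "trunc j (mon u * r x * mon v) \<in> P" for u x v
  proof (cases u)
    case Nil
    then show ?thesis using s5 by (simp add: mon_Nil)
  next
    case (Cons y u')
    then have "mon u * r x * mon v = mon [y] * (mon u' * r x * mon v)"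
      by (simp add: mon_mult flip: mult.assoc)
    then show ?thesis using s1 rel_ideal_gen by metis
  qed
  then have "{trunc j (mon u * r x * mon v) |u x v. True} \<subseteq> P" by blast
  then have "rel_trunc r j \<subseteq> P" unfolding rel_trunc_span by (rule FA.span_minimal[OF _ sub])
  then have "FA.dim (rel_trunc r j) \<le> card (T1 \<union> T2 \<union> T3)"
    unfolding P_def by (rule FA.dim_le_card) (simp add: T1_def T2_def T3_def fin finB)
  also have "\<dots> \<le> card T1 + card T2 + card T3"
    by (meson add_right_mono card_Un_le order_trans)
  also have "\<dots> \<le> card ((UNIV :: 'x set) \<times> B) + card ((UNIV :: 'x set) \<times> C) + card ((UNIV - {x0}) \<times> E)"
    unfolding T1_def T2_def T3_def by (intro add_mono card_image_le) (auto simp: fin finB)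
  also have "\<dots> = CARD('x) * FA.dim (rel_trunc r (j - 1)) + CARD('x) * card C + (CARD('x) - 1) * card E"
    by (simp add: card_cartesian_product B(4) i card_Diff_singleton)
  finally show ?thesis .
qed

end

lemma card_le_dim_low:
  assumes "FA.independent B" "B \<subseteq> V" "V \<subseteq> (low j :: ('x::finite, 'k::field) free_alg set)"
  shows "card B \<le> FA.dim V"
proof -
  obtain B' where B': "B' \<subseteq> V" "FA.independent B'" "V \<subseteq> FA.span B'" "card B' = FA.dim V"
    using FA.basis_exists by blast
  have "finite B'" using finite_dim_low_card(1)[OF B'(2)] B'(1) assms(3) by blast
  then show ?thesis
    using FA.independent_span_bound[OF _ assms(1)] B' assms(2) by (metis subset_trans)
qed

lemma low_subset_span_independent:
  assumes "FA.independent S" "S \<subseteq> (low j :: ('x::finite, 'k::field) free_alg set)"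
    and "card S = words_le TYPE('x) j"
  shows "low j \<subseteq> FA.span S"
proof (rule ccontr)
  assume "\<not> ?thesis"
  then obtain p where p: "p \<in> low j" "p \<notin> FA.span S" by blast
  then have "FA.independent (insert p S)" using assms(1) by (simp add: FA.independent_insertI)
  moreover have "p \<notin> S" using p FA.span_base by blast
  ultimately show False
    using finite_dim_low_card[of S j] finite_dim_low_card[of "insert p S" j] p assms by auto
qed

text \<open>The case of empty \<open>E\<close>: \<open>C\<close> completes a basis of
  \<open>rel_trunc r m\<close> to a basis of \<open>low m\<close>, so its size is the codimension.
  This is the classical Golod-Shafarevich inequality in cumulative form.\<close>

lemma (in potential_relations) dim_rel_trunc_le_complement:
  assumes "j = m + d"
  shows "FA.dim (rel_trunc r j) + CARD('x) * FA.dim (rel_trunc r m) \<le>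
    CARD('x) * FA.dim (rel_trunc r (j - 1)) + CARD('x) * words_le TYPE('x) m"
proof -
  obtain Q where Q: "Q \<subseteq> rel_trunc r m" "FA.independent Q" "rel_trunc r m \<subseteq> FA.span Q"
    "card Q = FA.dim (rel_trunc r m)" using FA.basis_exists by blast
  have "Q \<subseteq> low m" using Q(1) rel_trunc_low by blast
  then obtain S where S: "Q \<subseteq> S" "S \<subseteq> low m" "FA.independent S" "low m \<subseteq> FA.span S"
    using FA.maximal_independent_subset_extend Q(2) by metis
  have fin: "finite S" using finite_dim_low_card(1) S by blast
  have "low m \<subseteq> FA.span (S - Q \<union> (\<lambda>e. mon [undefined] * e) ` {} \<union> rel_trunc r m)"
    using S(4) FA.span_mono[of S "S - Q \<union> rel_trunc r m"] Q(1) by auto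
  from dim_rel_trunc_le[OF assms _ _ this] fin
  have D: "FA.dim (rel_trunc r j) \<le> CARD('x) * FA.dim (rel_trunc r (j - 1)) + CARD('x) * card (S - Q)"
    by simp
  have "card S = words_le TYPE('x) m"
    using FA.basis_card_eq_dim[OF S(2,4,3)] by (simp add: dim_low)
  moreover have "card (S - Q) + card Q = card S"
    using card_Diff_subset[OF finite_subset[OF S(1) fin] S(1)] card_mono[OF fin S(1)] by simp
  ultimately have "CARD('x) * words_le TYPE('x) m = CARD('x) * card (S - Q) + CARD('x) * card Q"
    by (simp flip: distrib_left)
  with D show ?thesis unfolding Q(4) by linarith
qed

section \<open>Specialization of a generic deformation\<close>

text \<open>A relation and not an evaluation map, since an element of the function field may have a
  pole at \<open>c\<close>. The witness \<open>p\<close> says that all coefficients of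
  \<open>v\<close> are polynomials.\<close>

definition specializes :: "'k::field \<Rightarrow> ('x, 'k) free_alg \<Rightarrow> ('x, 'k poly fract) free_alg \<Rightarrow> bool"
  where "specializes c s v \<longleftrightarrow> (\<exists>p. \<forall>w. Poly_Mapping.lookup v w = to_fract (p w) \<and>
    Poly_Mapping.lookup s w = poly (p w) c)"

lemma common_denominator:
  assumes "finite S"
  shows "\<exists>q a. q \<noteq> 0 \<and> (\<forall>s\<in>S. (f s :: 'a::idom fract) * to_fract q = to_fract (a s))"
  using assms
proof (induction S)
  case empty
  show ?case by (rule exI[of _ 1]) auto
next
  case (insert s S)
  then obtain q a where q: "q \<noteq> 0" "\<And>t. t \<in> S \<Longrightarrow> f t * to_fract q = to_fract (a t)" by blast
  obtain b e where e: "f s = Fract b e" "e \<noteq> 0" by (cases "f s") auto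
  then have fs: "f s * to_fract e = to_fract b" by (simp add: Fract_conv_to_fract)
  have "f t * to_fract (q * e) = to_fract (if t = s then b * q else a t * e)" if "t \<in> insert s S" for t
  proof (cases "t = s")
    case True
    then show ?thesis using fs by (simp add: mult.commute mult.left_commute)
  next
    case False
    then show ?thesis using q(2)[of t] that by (simp add: mult.assoc[symmetric])
  qed
  then show ?case
    using q e by (intro exI[of _ "q * e"] exI[of _ "\<lambda>t. if t = s then b * q else a t * e"]) auto
qed

lemma to_fract_sum: "to_fract (sum f A) = (\<Sum>a\<in>A. to_fract (f a))"
  by (induction A rule: infinite_finite_induct) auto

text \<open>
  A relation with polynomial coefficients specializes at \<open>c\<close> to a trivial one, so its coefficients
  are divisible by \<open>t - c\<close>; cancelling this factor and repeating, they are divisible by all powers.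
\<close>

lemma independence_lifts:
  assumes fin: "finite S" and ind: "FA.independent S" and spec: "\<And>s. s \<in> S \<Longrightarrow> specializes c s (g s)"
  shows "inj_on g S" "FA.independent (g ` S)"
proof -
  obtain p where p: "\<And>s w. s \<in> S \<Longrightarrow> Poly_Mapping.lookup (g s) w = to_fract (p s w)"
    "\<And>s w. s \<in> S \<Longrightarrow> Poly_Mapping.lookup s w = poly (p s w) c"
    using spec unfolding specializes_def by metis
  have eval: "poly (a s) c = 0"
    if "\<And>w. (\<Sum>s\<in>S. a s * p s w) = 0" "s \<in> S" for a s
  proof -
    have "(\<Sum>s\<in>S. scl (poly (a s) c) s) = 0"
    proof (rule poly_mapping_eqI)
      fix w
      have "(\<Sum>s\<in>S. poly (a s) c * Poly_Mapping.lookup s w) = poly (\<Sum>s\<in>S. a s * p s w) c"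
        by (simp add: poly_sum p(2))
      then show "Poly_Mapping.lookup (\<Sum>s\<in>S. scl (poly (a s) c) s) w = Poly_Mapping.lookup 0 w"
        using that(1) by (simp add: lookup_sum)
    qed
    then show ?thesis
      using FA.independent_explicit_finite_subsets[THEN iffD1, OF ind, rule_format,
          OF order_refl fin, of "\<lambda>s. poly (a s) c"] that(2) by blast
  qed
  have dvd: "[:- c, 1:] ^ N dvd a s"
    if "\<And>w. (\<Sum>s\<in>S. a s * p s w) = 0" "s \<in> S" for N a s
    using that
  proof (induction N arbitrary: a s)
    case (Suc N)
    have "[:- c, 1:] dvd a s" if "s \<in> S" for s
      using eval[OF Suc.prems(1) that] by (simp add: poly_eq_0_iff_dvd)
    then obtain b where b: "\<And>s. s \<in> S \<Longrightarrow> a s = [:- c, 1:] * b s" unfolding dvd_def by metis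
    have "(\<Sum>s\<in>S. b s * p s w) = 0" for w
    proof -
      have "[:- c, 1:] * (\<Sum>s\<in>S. b s * p s w) = (\<Sum>s\<in>S. a s * p s w)"
        by (simp only: sum_distrib_left) (rule sum.cong, simp_all add: b mult.assoc del: mult_pCons_left)
      then have "[:- c, 1:] * (\<Sum>s\<in>S. b s * p s w) = 0" using Suc.prems(1)[of w] by simp
      then show ?thesis unfolding mult_eq_0_iff by simp
    qed
    from Suc.IH[OF this Suc.prems(2)] show ?case
      using b[OF Suc.prems(2)] by (simp add: mult_dvd_mono del: mult_pCons_left)
  qed simp
  have zero: "a s = 0" if "\<And>w. (\<Sum>s\<in>S. a s * p s w) = 0" "s \<in> S" for a s
  proof (rule ccontr)
    assume "a s \<noteq> 0"
    then have "degree ([:- c, 1:] ^ Suc (degree (a s))) \<le> degree (a s)"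
      by (intro dvd_imp_degree_le dvd that)
    then show False by (simp only: degree_linear_power)
  qed
  have key: "f s = 0" if f: "(\<Sum>s\<in>S. scl (f s) (g s)) = 0" "s \<in> S" for f s
  proof -
    obtain q a where q: "q \<noteq> 0" "\<And>s. s \<in> S \<Longrightarrow> f s * to_fract q = to_fract (a s)"
      using common_denominator[OF fin, of f] by blast
    have "(\<Sum>s\<in>S. a s * p s w) = 0" for w
    proof -
      have "to_fract (\<Sum>s\<in>S. a s * p s w) = to_fract q * (\<Sum>s\<in>S. f s * to_fract (p s w))"
        unfolding to_fract_sum sum_distrib_left
        by (rule sum.cong) (auto simp flip: q(2) simp: mult_ac)
      also have "(\<Sum>s\<in>S. f s * to_fract (p s w)) = Poly_Mapping.lookup (\<Sum>s\<in>S. scl (f s) (g s)) w"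
        by (simp add: lookup_sum p(1))
      finally have "to_fract (\<Sum>s\<in>S. a s * p s w) = 0" by (simp only: f lookup_zero mult_zero_right)
      then show ?thesis by (simp only: to_fract_eq_0_iff)
    qed
    from zero[OF this f(2)] q show ?thesis using f(2) by (metis mult_eq_0_iff to_fract_eq_0_iff)
  qed
  show inj: "inj_on g S"
  proof (rule inj_onI, rule ccontr)
    fix s t assume st: "s \<in> S" "t \<in> S" "g s = g t" "s \<noteq> t"
    have "(\<Sum>u\<in>S. scl ((if u = s then 1 else 0) - (if u = t then 1 else 0)) (g u)) = 0"
      using st fin by (simp add: FA.scale_left_diff_distrib sum_subtractf if_distrib[of "\<lambda>c. scl c _"] cong: if_cong)
    from key[OF this st(1)] st(4) show False by simp
  qed
  have "(\<Sum>v\<in>g ` S. scl (u v) v) = 0 \<Longrightarrow> v \<in> g ` S \<Longrightarrow> u v = 0" for u v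
    using key[of "\<lambda>s. u (g s)"] inj by (auto simp: sum.reindex)
  then show "FA.independent (g ` S)"
    by (intro FA.independent_if_scalars_zero) (use fin in auto)
qed

text \<open>Meant for the relations of two potentials: differentiation is linear, so these deform
  into the derivatives of the deformed potential. The polynomials \<open>[:1, -1:]\<close> and
  \<open>[:0, 1:]\<close> are 1 - t and t.\<close>

definition deform :: "('x, 'k::field) free_alg \<Rightarrow> ('x, 'k) free_alg \<Rightarrow> ('x, 'k poly fract) free_alg"
  where "deform p q = scl (to_fract [:1, -1:]) (Poly_Mapping.map (\<lambda>a. to_fract [:a:]) p)
    + scl (to_fract [:0, 1:]) (Poly_Mapping.map (\<lambda>a. to_fract [:a:]) q)"

text \<open>Written with a single \<open>to_fract\<close> outside, the coefficient displays the
  polynomial that \<open>specializes\<close> asks for.\<close>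

lemma lookup_deform:
  fixes p q :: "('x, 'k::field) free_alg"
  shows "Poly_Mapping.lookup (deform p q) w =
    to_fract ([:1, -1:] * [:Poly_Mapping.lookup p w:] + [:0, 1:] * [:Poly_Mapping.lookup q w:])"
proof -
  have "Poly_Mapping.lookup (Poly_Mapping.map (\<lambda>a. to_fract [:a:]) p) w = to_fract [:Poly_Mapping.lookup p w:]"
    for p :: "('x, 'k) free_alg"
    by (simp add: Poly_Mapping.map.rep_eq when_def)
  then show ?thesis
    unfolding deform_def lookup_add lookup_scl to_fract_add to_fract_mult by simp
qed

lemma deform_zero [simp]: "deform 0 0 = 0"
  by (rule poly_mapping_eqI) (simp add: lookup_deform)

lemma deform_add: "deform (p + p') (q + q') = deform p q + deform p' q'"
proof (rule poly_mapping_eqI)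
  fix w
  have *: "[:a + b:] = [:a:] + [:b:]" for a b :: 'b by simp
  show "Poly_Mapping.lookup (deform (p + p') (q + q')) w = Poly_Mapping.lookup (deform p q + deform p' q') w"
    unfolding lookup_deform lookup_add * to_fract_add[symmetric] by (simp only: algebra_simps)
qed

lemma deform_sum: "deform (sum f A) (sum g A) = (\<Sum>a\<in>A. deform (f a) (g a))"
  by (induction A rule: infinite_finite_induct) (auto simp: deform_add)

lemma mon_mult_deform: "mon u * deform p q = deform (mon u * p) (mon u * q)"
  by (rule poly_mapping_eqI) (simp add: lookup_deform lookup_mon_mult)

lemma deform_mult_mon: "deform p q * mon u = deform (p * mon u) (q * mon u)"
  by (rule poly_mapping_eqI) (simp add: lookup_deform lookup_mult_mon)

lemma trunc_deform: "trunc j (deform p q) = deform (trunc j p) (trunc j q)"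
  by (rule poly_mapping_eqI) (simp add: lookup_deform lookup_trunc)

lemma specializes_deform: "specializes 0 p (deform p q)" "specializes 1 q (deform p q)"
  unfolding specializes_def lookup_deform by (rule exI, fastforce)+

lemma specializes_mon: "specializes c (mon w) (mon w)"
  unfolding specializes_def by (rule exI[of _ "\<lambda>v. if v = w then 1 else 0"]) (simp add: lookup_mon)

lemma potential_relations_deform:
  assumes "potential_relations r d" "potential_relations r' d"
  shows "potential_relations (\<lambda>x. deform (r x) (r' x)) d"
proof -
  interpret r: potential_relations r d by fact
  interpret r': potential_relations r' d by fact
  show ?thesis
  proof
    show "(\<Sum>x\<in>UNIV. mon [x] * deform (r x) (r' x)) = (\<Sum>x\<in>UNIV. deform (r x) (r' x) * mon [x])"
      unfolding mon_mult_deform deform_mult_mon deform_sum[symmetric] r.cyclic r'.cyclic ..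
    show "deform (r x) (r' x) \<in> deg_ge d" for x
      using r.deg r'.deg by (simp add: deg_ge_def lookup_deform)
    show "d > 0" by (rule r.d_pos)
  qed
qed

lemma rel_trunc_specializes:
  assumes "s \<in> {trunc j (mon u * r x * mon v) | u x v. True}"
  shows "\<exists>t\<in>rel_trunc (\<lambda>x. deform (r x) (r' x)) j. specializes 0 s t"
    "\<exists>t\<in>rel_trunc (\<lambda>x. deform (r' x) (r x)) j. specializes 1 s t"
proof -
  obtain u x v where s: "s = trunc j (mon u * r x * mon v)" using assms by blast
  have gen: "trunc j (mon u * q x * mon v) \<in> rel_trunc q j" for q :: "'a \<Rightarrow> ('a, 'b poly fract) free_alg"
    unfolding rel_trunc_def by (rule imageI[OF rel_ideal_gen])
  show "\<exists>t\<in>rel_trunc (\<lambda>x. deform (r x) (r' x)) j. specializes 0 s t"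
    using gen[of "\<lambda>x. deform (r x) (r' x)"]
    unfolding s mon_mult_deform deform_mult_mon trunc_deform
    by (rule bexI[rotated]) (rule specializes_deform)
  show "\<exists>t\<in>rel_trunc (\<lambda>x. deform (r' x) (r x)) j. specializes 1 s t"
    using gen[of "\<lambda>x. deform (r' x) (r x)"]
    unfolding s mon_mult_deform deform_mult_mon trunc_deform
    by (rule bexI[rotated]) (rule specializes_deform)
qed

lemma rel_trunc_gens_low: "{trunc j (mon u * r x * mon v) | u x v. True} \<subseteq> low j"
  by (auto simp: trunc_in_low)

text \<open>Rank can only drop under specialization. The basis is chosen among the generators,
  because each of them has an evident lift: the same product formed with the deformed
  relation.\<close>

lemma dim_rel_trunc_le_deform:
  fixes r :: "'x::finite \<Rightarrow> ('x, 'k::field) free_alg"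
  shows "FA.dim (rel_trunc r j) \<le> FA.dim (rel_trunc (\<lambda>x. deform (r x) (r' x)) j)"
proof -
  let ?G = "{trunc j (mon u * r x * mon v) | u x v. True}"
  obtain S where S: "S \<subseteq> ?G" "FA.independent S" "?G \<subseteq> FA.span S" "card S = FA.dim ?G"
    using FA.basis_exists by blast
  have fin: "finite S" by (rule finite_dim_low_card(1)[OF S(2) subset_trans[OF S(1) rel_trunc_gens_low]])
  have "\<forall>s\<in>S. \<exists>t. t \<in> rel_trunc (\<lambda>x. deform (r x) (r' x)) j \<and> specializes 0 s t"
    using rel_trunc_specializes(1)[of _ j r r'] S(1) by blast
  then obtain g where g: "\<And>s. s \<in> S \<Longrightarrow> g s \<in> rel_trunc (\<lambda>x. deform (r x) (r' x)) j"
    "\<And>s. s \<in> S \<Longrightarrow> specializes 0 s (g s)" by metis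
  note lift = independence_lifts[OF fin S(2) g(2)]
  have "FA.dim (rel_trunc r j) = card S"
    by (simp only: rel_trunc_span FA.dim_span S(4))
  also have "\<dots> = card (g ` S)" by (rule card_image[symmetric, OF lift(1)])
  also have "\<dots> \<le> FA.dim (rel_trunc (\<lambda>x. deform (r x) (r' x)) j)"
    by (rule card_le_dim_low[OF lift(2) _ rel_trunc_low]) (use g(1) in auto)
  finally show ?thesis .
qed

text \<open>Only independence lifts, so spanning is transferred by counting. The words of
  \<open>B\<close> are completed by generators to a basis of \<open>low m\<close>; the lift at t =
  1, which fixes words, is independent and has as many elements as there are words of length at most
  \<open>m\<close>, hence is again a basis.\<close>

lemma low_subset_span_deform:
  fixes r :: "'x::finite \<Rightarrow> ('x, 'k::field) free_alg"
  assumes B: "\<And>w. w \<in> B \<Longrightarrow> length w \<le> m"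
    and sp: "low m \<subseteq> FA.span (mon ` B \<union> rel_trunc r m)"
  shows "low m \<subseteq> FA.span (mon ` B \<union> rel_trunc (\<lambda>x. deform (r' x) (r x)) m)"
proof -
  let ?G = "{trunc m (mon u * r x * mon v) | u x v. True}"
  let ?R = "rel_trunc (\<lambda>x. deform (r' x) (r x)) m"
  obtain S where S: "mon ` B \<subseteq> S" "S \<subseteq> mon ` B \<union> ?G" "FA.independent S" "mon ` B \<union> ?G \<subseteq> FA.span S"
    using FA.maximal_independent_subset_extend[of "mon ` B" "mon ` B \<union> ?G"] independent_mon by blast
  have Blow: "mon ` B \<subseteq> (low m :: ('x, 'a::field) free_alg set)"
    by (auto simp: low_def lookup_mon dest!: B)
  have Slow: "S \<subseteq> low m" by (rule subset_trans[OF S(2) Un_least[OF Blow rel_trunc_gens_low]])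
  have fin: "finite S" using finite_dim_low_card(1)[OF S(3) Slow] .
  have "rel_trunc r m \<subseteq> FA.span S"
    unfolding rel_trunc_span by (rule FA.span_minimal) (use S(4) in auto)
  then have "FA.span (mon ` B \<union> rel_trunc r m) \<subseteq> FA.span S"
    using S(4) by (intro FA.span_minimal) auto
  with sp have "low m \<subseteq> FA.span S" by (rule subset_trans)
  then have "card S = words_le TYPE('x) m"
    using FA.basis_card_eq_dim[OF Slow _ S(3)] by (simp add: dim_low)
  moreover have "\<forall>s\<in>S. \<exists>t. t \<in> mon ` B \<union> ?R \<and> specializes 1 s t"
  proof
    fix s assume "s \<in> S"
    with S(2) consider w where "w \<in> B" "s = mon w" | "s \<in> ?G" by blast
    then show "\<exists>t. t \<in> mon ` B \<union> ?R \<and> specializes 1 s t"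
    proof cases
      case 1
      then show ?thesis using specializes_mon[of 1 w] by blast
    next
      case 2
      from rel_trunc_specializes(2)[OF this, of r'] show ?thesis by blast
    qed
  qed
  then obtain g where g: "\<And>s. s \<in> S \<Longrightarrow> g s \<in> mon ` B \<union> ?R"
    "\<And>s. s \<in> S \<Longrightarrow> specializes 1 s (g s)" by metis
  note lift = independence_lifts[OF fin S(3) g(2)]
  have "g ` S \<subseteq> low m" by (rule subset_trans[OF _ Un_least[OF Blow rel_trunc_low]]) (use g(1) in auto)
  ultimately have "low m \<subseteq> FA.span (g ` S)"
    using low_subset_span_independent[OF lift(2)] card_image[OF lift(1)] by auto
  also have "\<dots> \<subseteq> FA.span (mon ` B \<union> ?R)" by (rule FA.span_mono) (use g(1) in auto)
  finally show ?thesis .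
qed

text \<open>Induction on \<open>j\<close> for the deformed relations, whose spanning words are
  inherited from \<open>r'\<close>. Of the \<beta>_m spanning words, \<beta>_(m-1) have the form x0
  e, so the estimate costs n (\<beta>_m - \<beta>_(m-1)) + (n - 1) \<beta>_(m-1) = n \<beta>_m -
  \<beta>_(m-1) generators. Since the number of words satisfies w_j = 1 + n w_(j-1),
  \<open>rec0\<close> and \<open>rec\<close> are precisely what the induction step demands.\<close>

theorem good_potential_bound:
  fixes r r' :: "'x::finite \<Rightarrow> ('x, 'k::field) free_alg" and B :: "'x list set"
  defines "\<beta> j \<equiv> card {w \<in> B. length w \<le> j}"
  assumes pot: "potential_relations r d" "potential_relations r' d"
    and B: "\<And>w. w \<in> B \<Longrightarrow> x0 # w \<in> B"
    and sp: "\<And>m. low m \<subseteq> FA.span (mon ` {w \<in> B. length w \<le> m} \<union> rel_trunc r' m)"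
    and rec0: "\<beta> d + CARD('x) * \<beta> 0 \<le> 1 + CARD('x) * \<beta> (d - 1)"
    and rec: "\<And>m. \<beta> (Suc m + d) + CARD('x) * \<beta> (Suc m) \<le> 1 + CARD('x) * \<beta> (m + d) + \<beta> m"
  shows "\<beta> j + FA.dim (rel_trunc r j) \<le> words_le TYPE('x) j"
proof -
  let ?q = "\<lambda>x. deform (r x) (r' x)"
  let ?n = "CARD('x)"
  interpret q: potential_relations ?q d by (rule potential_relations_deform[OF pot])
  have finB: "finite {w \<in> B. length w \<le> j}" for j
    by (rule finite_subset[OF _ finite_words[of j]]) auto
  have "\<beta> j + FA.dim (rel_trunc ?q j) \<le> words_le TYPE('x) j"
  proof (induction j)
    case 0
    have "FA.dim (rel_trunc ?q 0) = 0"
      using FA.dim_le_card[of "{0}" "{}"] by (simp add: q.rel_trunc_eq_0[OF q.d_pos])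
    moreover have "\<beta> 0 \<le> words_le TYPE('x) 0"
      unfolding \<beta>_def words_le_def by (rule card_mono[OF finite_words]) auto
    ultimately show ?case by simp
  next
    case (Suc i)
    show ?case
    proof (cases "Suc i < d")
      case True
      have "FA.dim (rel_trunc ?q (Suc i)) = 0"
        using FA.dim_le_card[of "{0}" "{}"] by (simp add: q.rel_trunc_eq_0[OF True])
      moreover have "\<beta> (Suc i) \<le> words_le TYPE('x) (Suc i)"
        unfolding \<beta>_def words_le_def by (rule card_mono[OF finite_words]) auto
      ultimately show ?thesis by simp
    next
      case False
      then obtain m where m: "Suc i = m + d" by (metis add.commute le_Suc_ex not_less)
      \<comment> \<open>For \<open>m = 0\<close> the subtraction on naturals would give
        \<open>m - 1 = 0\<close> and admit the empty word to \<open>E\<close>, although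
        \<open>[x0]\<close> is already too long.\<close>
      define E where "E = (if m = 0 then {} else {w \<in> B. length w \<le> m - 1})"
      define \<epsilon> where "\<epsilon> = card E"
      let ?C = "{w \<in> B. length w \<le> m} - (#) x0 ` E"
      have finE: "finite E" by (simp add: E_def finB)
      have sub: "(#) x0 ` E \<subseteq> {w \<in> B. length w \<le> m}"
        by (auto simp: E_def B split: if_splits)
      have cC: "card ?C + \<epsilon> = \<beta> m"
        using card_Diff_subset[OF finite_imageI[OF finE] sub] card_mono[OF finB sub]
        by (simp add: \<beta>_def \<epsilon>_def card_image)
      have "mon ` {w \<in> B. length w \<le> m} =
          mon ` ?C \<union> (\<lambda>e. mon [x0] * e) ` (mon ` E :: ('x, 'k poly fract) free_alg set)"
      proof -
        have "{w \<in> B. length w \<le> m} = ?C \<union> (#) x0 ` E" using sub by blast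
        then have "mon ` {w \<in> B. length w \<le> m} =
            (mon ` (?C \<union> (#) x0 ` E) :: ('x, 'k poly fract) free_alg set)" by (rule arg_cong)
        then show ?thesis
          by (simp only: image_Un image_image mon_mult append_Cons append_Nil)
      qed
      then have "low m \<subseteq> FA.span (mon ` ?C \<union> (\<lambda>e. mon [x0] * e) ` (mon ` E) \<union> rel_trunc ?q m)"
        using low_subset_span_deform[OF _ sp[of m], of r] by simp
      moreover have "mon [x] * e \<in> low m" if "e \<in> mon ` E" for e :: "('x, 'k poly fract) free_alg" and x
        using that by (auto simp: E_def mon_mult low_def lookup_mon split: if_splits)
      moreover have "finite (mon ` ?C :: ('x, 'k poly fract) free_alg set)"
        "finite (mon ` E :: ('x, 'k poly fract) free_alg set)" using finE finB by auto
      ultimately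
      have "FA.dim (rel_trunc ?q (Suc i)) \<le> ?n * FA.dim (rel_trunc ?q i)
          + ?n * card (mon ` ?C :: ('x, 'k poly fract) free_alg set) + (?n - 1) * card (mon ` E :: ('x, 'k poly fract) free_alg set)"
        using q.dim_rel_trunc_le[OF m, of "mon ` ?C" "mon ` E" x0] by simp
      then have D: "FA.dim (rel_trunc ?q (Suc i)) \<le> ?n * FA.dim (rel_trunc ?q i) + ?n * card ?C + (?n - 1) * \<epsilon>"
        by (simp add: card_image[OF inj_mon] \<epsilon>_def)
      have "?n * card ?C + (?n - 1) * \<epsilon> + \<epsilon> = ?n * \<beta> m"
        by (simp add: cC[symmetric] distrib_left mult_eq_if[of ?n])
      moreover have "\<beta> (Suc i) + ?n * \<beta> m \<le> 1 + ?n * \<beta> i + \<epsilon>"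
      proof (cases m)
        case 0
        with m have "d - 1 = i" "Suc i = d" by simp_all
        then show ?thesis using rec0 0 by (simp add: \<epsilon>_def E_def)
      next
        case (Suc m')
        then show ?thesis using rec[of m'] m by (simp add: \<epsilon>_def E_def \<beta>_def)
      qed
      ultimately have "\<beta> (Suc i) + FA.dim (rel_trunc ?q (Suc i)) \<le> 1 + (?n * \<beta> i + ?n * FA.dim (rel_trunc ?q i))"
        using D by linarith
      also have "\<dots> \<le> 1 + ?n * words_le TYPE('x) i"
        using mult_le_mono2[OF Suc.IH, of ?n] by (simp add: distrib_left)
      finally show ?thesis by (simp add: words_le_Suc)
    qed
  qed
  then show ?thesis using dim_rel_trunc_le_deform[of r j r'] by linarith
qed

section \<open>Quotients of the free algebra\<close>

lemma ring_of_type_algebra_simps [simp]: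
  "carrier ring_of_type_algebra = UNIV"
  "x \<otimes>\<^bsub>ring_of_type_algebra\<^esub> y = x * y" "\<one>\<^bsub>ring_of_type_algebra\<^esub> = 1"
  "x \<oplus>\<^bsub>ring_of_type_algebra\<^esub> y = x + y" "\<zero>\<^bsub>ring_of_type_algebra\<^esub> = 0"
  by (simp_all add: ring_of_type_algebra_def)

lemma ring_FA: "ring (FA :: ('x, 'k::field) free_alg ring)"
proof -
  have "\<exists>y. x + y = 0" for x :: "('x, 'k) free_alg"
    using add.right_inverse by blast
  then show ?thesis
    unfolding ring_of_type_algebra_def using add.right_inverse
    by unfold_locales (auto simp: algebra_simps Units_def)
qed

lemma ideal_FA:
  assumes "FA.subspace I" "\<And>p q. p \<in> I \<Longrightarrow> q * p \<in> I" "\<And>p q. p \<in> I \<Longrightarrow> p * q \<in> I"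
  shows "ideal I (FA :: ('x, 'k::field) free_alg ring)"
proof (rule idealI[OF ring_FA])
  interpret ring "FA :: ('x, 'k) free_alg ring" by (rule ring_FA)
  show "subgroup I (add_monoid (FA :: ('x, 'k) free_alg ring))"
  proof (rule group.subgroupI)
    show "group (add_monoid (FA :: ('x, 'k) free_alg ring))" by (rule add.is_group)
    show "inv\<^bsub>add_monoid FA\<^esub> p \<in> I" if "p \<in> I" for p
    proof -
      have "inv\<^bsub>add_monoid FA\<^esub> p = - p"
        using minus_equality[of "- p" p] by (simp add: a_inv_def)
      then show ?thesis using FA.subspace_neg[OF assms(1) that] by simp
    qed
    show "I \<noteq> {}" using FA.subspace_0[OF assms(1)] by blast
  qed (use FA.subspace_add[OF assms(1)] in auto)
qed (use assms in auto)

lemma scalar_plus: "scalar (a + b) = scalar a + scalar b"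
  by (simp add: scalar_def single_add)

lemma scalar_times: "scalar (a * b) = scalar a * scalar b"
  by (simp add: scalar_def mult_single plus_list_def)

lemma scalar_1: "scalar 1 = 1"
  by (simp add: scalar_def flip: zero_list_def)

text \<open>Upper bounds for dimensions come from spanning lists that may be dependent, while
  \<open>independent_length_le\<close> compares two independent lists.\<close>

lemma (in ring) short_base:
  assumes K: "subfield K R" and "set Us \<subseteq> carrier R"
  shows "\<exists>Vs. independent K Vs \<and> Span K Vs = Span K Us \<and> length Vs \<le> length Us"
  using assms(2)
proof (induction Us)
  case (Cons u Us)
  then obtain Vs where Vs: "independent K Vs" "Span K Vs = Span K Us" "length Vs \<le> length Us"
    by auto
  show ?case
  proof (cases "u \<in> Span K Us")
    case True
    then have "Span K (u # Us) = Span K Us"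
      using Span_base_incl[OF K] mono_Span_subset[OF K]
      by (metis Cons.prems insert_subset list.simps(15) subset_antisym)
    then show ?thesis using Vs by (metis le_SucI length_Cons)
  next
    case False
    then have "Span K (u # Vs) = Span K (u # Us)" "independent K (u # Vs)"
      using li_Cons[of u K Vs] Cons(2) Vs by auto
    then show ?thesis using Vs(3) by (metis Suc_le_mono length_Cons)
  qed
qed auto

text \<open>Stated for an arbitrary proper ideal, because the quotients by the ideal of relations,
  by its truncations and by its completion all need the same passage from spans in the free algebra
  to dimensions in the quotient.\<close>

locale proper_ideal_FA = ideal L "FA :: ('x, 'k::field) free_alg ring"
  for L :: "('x, 'k::field) free_alg set" +
  assumes one_notin: "1 \<notin> L"
begin

abbreviation Q where "Q \<equiv> FA Quot L"
abbreviation coset where "coset p \<equiv> L +>\<^bsub>FA\<^esub> p"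

sublocale Q: ring Q by (rule quotient_is_ring)

lemma add_closed: "p \<in> L \<Longrightarrow> q \<in> L \<Longrightarrow> p + q \<in> L"
  using additive_subgroup.a_closed[OF is_additive_subgroup] by simp

lemma mult_closed: "p \<in> L \<Longrightarrow> q * p \<in> L" "p \<in> L \<Longrightarrow> p * q \<in> L"
  using I_l_closed I_r_closed by simp_all

lemma subspace: "FA.subspace L"
  using additive_subgroup.zero_closed[OF is_additive_subgroup] add_closed mult_closed by (auto simp: FA.subspace_def scl_def)

lemma coset_eq_iff: "coset p = coset q \<longleftrightarrow> p - q \<in> L"
proof -
  have co: "coset p = {h + p |h. h \<in> L}" for p
    by (auto simp: a_r_coset_def')
  show ?thesis
  proof
    assume "coset p = coset q"
    moreover have "p \<in> coset p" using FA.subspace_0[OF subspace] by (force simp: co)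
    ultimately show "p - q \<in> L" by (auto simp: co)
  next
    assume pq: "p - q \<in> L"
    have "h + p = (h + (p - q)) + q" "h + q = (h - (p - q)) + p" for h by simp_all
    then show "coset p = coset q"
      using pq FA.subspace_add[OF subspace] FA.subspace_diff[OF subspace]
      unfolding co by blast
  qed
qed

lemma carrier_Q: "carrier Q = range coset"
  by (auto simp: FactRing_def A_RCOSETS_def')

lemma coset_simps:
  "coset p \<otimes>\<^bsub>Q\<^esub> coset q = coset (p * q)" "coset p \<oplus>\<^bsub>Q\<^esub> coset q = coset (p + q)"
  "\<zero>\<^bsub>Q\<^esub> = coset 0" "\<one>\<^bsub>Q\<^esub> = coset 1"
proof -
  interpret h: ring_hom_ring FA Q coset by (rule rcos_ring_hom_ring)
  show "coset p \<otimes>\<^bsub>Q\<^esub> coset q = coset (p * q)" "coset p \<oplus>\<^bsub>Q\<^esub> coset q = coset (p + q)"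
    "\<zero>\<^bsub>Q\<^esub> = coset 0" "\<one>\<^bsub>Q\<^esub> = coset 1"
    using h.hom_mult[of p q] h.hom_add[of p q] h.hom_zero h.hom_one by simp_all
qed

lemma subfield_ground_field: "subfield (ground_field L) Q"
proof -
  let ?K = "ring_of_type_algebra :: 'k ring"
  have K: "field ?K" by (rule field_from_type_algebra)
  interpret h: ring_hom_ring ?K Q "\<lambda>c. coset (scalar c)"
  proof (rule ring_hom_ringI)
    show "ring ?K" by (rule ring_from_type_algebra)
    show "ring Q" by (rule quotient_is_ring)
    show "coset (scalar \<one>\<^bsub>?K\<^esub>) = \<one>\<^bsub>Q\<^esub>"
      by (simp add: scalar_1 coset_simps)
  qed (auto simp: carrier_Q coset_simps scalar_plus scalar_times)
  have "\<one>\<^bsub>Q\<^esub> \<noteq> \<zero>\<^bsub>Q\<^esub>"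
    using one_notin by (simp add: coset_simps coset_eq_iff)
  from h.img_is_subfield(2)[OF field.carrier_is_subfield[OF K] this]
  have "subfield ((\<lambda>c. coset (scalar c)) ` carrier ?K) Q" .
  moreover have "(\<lambda>c. coset (scalar c)) ` carrier ?K = ground_field L"
    by (auto simp: ground_field_def)
  ultimately show ?thesis by simp
qed

lemma Span_coset: "Q.Span (ground_field L) (map coset ps) = coset ` FA.span (set ps)"
proof (induction ps)
  case Nil
  show ?case by (simp add: coset_simps)
next
  case (Cons p ps)
  have "Q.Span (ground_field L) (map coset (p # ps)) =
      Q.line_extension (ground_field L) (coset p) (coset ` FA.span (set ps))"
    using Cons by simp
  also have "\<dots> = {coset (scl c p + s) | c s. s \<in> FA.span (set ps)}"
  proof (rule Set.set_eqI)
    fix u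
    have "coset (scl c p + s) = coset (scalar c) \<otimes>\<^bsub>Q\<^esub> coset p \<oplus>\<^bsub>Q\<^esub> coset s" for c s
      by (simp add: coset_simps scl_def)
    then show "u \<in> Q.line_extension (ground_field L) (coset p) (coset ` FA.span (set ps)) \<longleftrightarrow>
        u \<in> {coset (scl c p + s) | c s. s \<in> FA.span (set ps)}"
      unfolding Q.line_extension_mem_iff ground_field_def by auto
  qed
  also have "\<dots> = coset ` {scl c p + s | c s. s \<in> FA.span (set ps)}"
    by blast
  also have "{scl c p + s | c s. s \<in> FA.span (set ps)} = FA.span (set (p # ps))"
  proof -
    have "x = scl c p + s \<longleftrightarrow> s = x - scl c p" for x c s by (auto simp: algebra_simps)
    then show ?thesis unfolding list.set FA.span_insert by auto
  qed
  finally show ?case .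
qed

lemma coset_lift: "set Us \<subseteq> carrier Q \<Longrightarrow> \<exists>ps. Us = map coset ps"
  by (metis carrier_Q ex_map_conv imageE subsetD)

lemma finite_dimension_lift:
  assumes "Q.dimension n (ground_field L) E"
  shows "\<exists>ps. length ps = n \<and> E = coset ` FA.span (set ps)"
  using Q.exists_base[OF subfield_ground_field assms] coset_lift Span_coset by (metis length_map)

text \<open>The premise secures that \<open>E\<close> has finite dimension, without which the number
  \<open>Q.dim\<close> would carry no information. The first premise of \<open>dim_coset_le\<close>
  has the same purpose.\<close>

lemma dim_coset_lift:
  assumes "E = coset ` FA.span (set ps)"
  shows "\<exists>qs. length qs = Q.dim (ground_field L) E \<and> E = coset ` FA.span (set qs)"
proof -
  have "Q.finite_dimension (ground_field L) (Q.Span (ground_field L) (map coset ps))"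
    by (rule Q.Span_finite_dimension[OF subfield_ground_field]) (auto simp: carrier_Q)
  then have "Q.dimension (Q.dim (ground_field L) E) (ground_field L) E"
    using Q.finite_dimensionE[OF subfield_ground_field] by (simp only: assms Span_coset over_def)
  then show ?thesis by (rule finite_dimension_lift)
qed

lemma dim_coset_le:
  assumes "E = coset ` FA.span (set ps)" "E \<subseteq> coset ` FA.span (set qs)"
  shows "Q.dim (ground_field L) E \<le> length qs"
proof -
  have E: "E = Q.Span (ground_field L) (map coset ps)" by (simp only: assms(1) Span_coset)
  have "Q.finite_dimension (ground_field L) E"
    unfolding E by (rule Q.Span_finite_dimension[OF subfield_ground_field]) (auto simp: carrier_Q)
  then have dE: "Q.dimension (Q.dim (ground_field L) E) (ground_field L) E"
    using Q.finite_dimensionE[OF subfield_ground_field] by (simp add: over_def)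
  from Q.exists_base[OF subfield_ground_field this] obtain Us where Us:
    "Q.independent (ground_field L) Us" "length Us = Q.dim (ground_field L) E"
    "Q.Span (ground_field L) Us = E" "set Us \<subseteq> carrier Q" by blast
  have "set Us \<subseteq> Q.Span (ground_field L) (map coset qs)"
    unfolding Span_coset
    using Q.Span_base_incl[OF subfield_ground_field Us(4), unfolded Us(3)] assms(2) by (rule subset_trans)
  moreover obtain Vs where Vs: "Q.independent (ground_field L) Vs"
    "Q.Span (ground_field L) Vs = Q.Span (ground_field L) (map coset qs)" "length Vs \<le> length qs"
    using Q.short_base[OF subfield_ground_field, of "map coset qs"] by (auto simp: carrier_Q simp del: Q.Span.simps)
  ultimately show ?thesis
    using Q.independent_length_le[OF subfield_ground_field Us(1) Vs(1)] Us(2) by simp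
qed

end

section \<open>Growth of potential algebras\<close>

lemma (in proper_ideal_FA) coset_image_subset_iff:
  "coset ` A \<subseteq> coset ` B \<longleftrightarrow> (\<forall>p\<in>A. \<exists>s\<in>B. p - s \<in> L)"
  unfolding image_subset_iff image_iff coset_eq_iff ..

lemma lookup_nc_deriv: "Poly_Mapping.lookup (nc_deriv x F) w = Poly_Mapping.lookup F (x # w)"
  unfolding nc_deriv_def
proof (induction F rule: FA_induct)
  case (mon v)
  then show ?case by (cases v) (auto simp: lookup_mon)
qed (auto simp: lookup_add)

lemma lookup_cyc_rot:
  "Poly_Mapping.lookup (cyc_rot F) w =
    (if w = [] then Poly_Mapping.lookup F [] else Poly_Mapping.lookup F (last w # butlast w))"
  unfolding cyc_rot_def
proof (induction F rule: FA_induct)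
  case (mon v)
  then show ?case by (cases v; cases w rule: rev_cases) (auto simp: lookup_mon)
qed (auto simp: lookup_add)

lemma lookup_homog_comp:
  "Poly_Mapping.lookup (homog_comp j F) w = (if length w = j then Poly_Mapping.lookup F w else 0)"
  unfolding homog_comp_def
  by (induction F rule: FA_induct) (auto simp: lookup_add lookup_mon)

lemma potentials_from_iff:
  "F \<in> potentials_from k \<longleftrightarrow> cyc_rot F = F \<and> (\<forall>w. length w < k \<longrightarrow> Poly_Mapping.lookup F w = 0)"
proof -
  have "homog_comp j F = 0 \<longleftrightarrow> (\<forall>w. length w = j \<longrightarrow> Poly_Mapping.lookup F w = 0)" for j
    by (metis lookup_homog_comp lookup_zero poly_mapping_eqI)
  then show ?thesis by (auto simp: potentials_from_def potentials_def)
qed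

lemma potentials_from_mono: "k \<le> k' \<Longrightarrow> potentials_from k' \<subseteq> potentials_from k"
  by (auto simp: potentials_from_iff)

text \<open>Removing the first letter of every monomial and restoring it on the left gives back F,
  which has no constant term. Restoring it on the right gives the rotated potential, which is F
  again.\<close>

lemma potential_relations_nc_deriv:
  fixes F :: "('x::finite, 'k::field) free_alg"
  assumes F: "F \<in> potentials_from k" and k: "k \<ge> 2"
  shows "potential_relations (\<lambda>x. nc_deriv x F) (k - 1)"
proof
  show "(\<Sum>x\<in>UNIV. mon [x] * nc_deriv x F) = (\<Sum>x\<in>UNIV. nc_deriv x F * mon [x])"
  proof (rule poly_mapping_eqI)
    fix w :: "'x list"
    have F': "Poly_Mapping.lookup F w = (if w = [] then 0 else Poly_Mapping.lookup F (last w # butlast w))"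
    proof -
      have "Poly_Mapping.lookup F [] = 0" using F k by (simp add: potentials_from_iff)
      moreover have "Poly_Mapping.lookup F w = Poly_Mapping.lookup (cyc_rot F) w"
        using F by (simp add: potentials_from_iff)
      ultimately show ?thesis by (simp add: lookup_cyc_rot)
    qed
    have "Poly_Mapping.lookup (\<Sum>x\<in>UNIV. mon [x] * nc_deriv x F) w = Poly_Mapping.lookup F w"
      using F k by (cases w) (simp_all add: lookup_sum lookup_mon_mult lookup_nc_deriv potentials_from_iff)
    also have "\<dots> = Poly_Mapping.lookup (\<Sum>x\<in>UNIV. nc_deriv x F * mon [x]) w"
      unfolding F' by (cases w rule: rev_cases) (simp_all add: lookup_sum lookup_mult_mon lookup_nc_deriv)
    finally show "Poly_Mapping.lookup (\<Sum>x\<in>UNIV. mon [x] * nc_deriv x F) w =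
      Poly_Mapping.lookup (\<Sum>x\<in>UNIV. nc_deriv x F * mon [x]) w" .
  qed
  show "nc_deriv x F \<in> deg_ge (k - 1)" for x
    using F k by (auto simp: deg_ge_def lookup_nc_deriv potentials_from_iff)
  show "k - 1 > 0" using k by simp
qed

section \<open>The ideals that define the algebras, and their truncations\<close>

lemma ideal_pot_ideal: "ideal (pot_ideal F) FA"
  unfolding pot_ideal_def by (rule ring.genideal_ideal[OF ring_FA]) simp

lemma ideal_high_ideal: "ideal (high_ideal j) FA"
  unfolding high_ideal_def by (rule ring.genideal_ideal[OF ring_FA]) simp

lemma ideal_trunc_ideal: "ideal (trunc_ideal F j) FA"
  unfolding trunc_ideal_def by (rule ring.add_ideals[OF ring_FA ideal_pot_ideal ideal_high_ideal])

lemma ideal_pot_ideal_completion: "ideal (pot_ideal_completion F) FA"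
  unfolding pot_ideal_completion_def by (rule ring.i_Intersect[OF ring_FA]) (auto intro: ideal_trunc_ideal)

lemma pot_ideal_subset: "pot_ideal F \<subseteq> rel_ideal (\<lambda>x. nc_deriv x F)"
  unfolding pot_ideal_def
proof (rule ring.genideal_minimal[OF ring_FA])
  show "ideal (rel_ideal (\<lambda>x. nc_deriv x F)) FA"
    by (rule ideal_FA[OF subspace_rel_ideal rel_ideal_mult_left rel_ideal_mult_right])
  show "{nc_deriv x F |x. True} \<subseteq> rel_ideal (\<lambda>x. nc_deriv x F)"
    using rel_in_rel_ideal[of "\<lambda>x. nc_deriv x F"] by blast
qed

lemma deg_ge_mult:
  assumes "p \<in> deg_ge d"
  shows "q * p \<in> deg_ge d" "p * q \<in> deg_ge d"
proof -
  note closed = FA.subspace_0[OF subspace_deg_ge] FA.subspace_add[OF subspace_deg_ge]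
    FA.subspace_scale[OF subspace_deg_ge]
  show "q * p \<in> deg_ge d"
  proof (induction q rule: FA_induct)
    case (mon w)
    show ?case using assms by (auto simp: deg_ge_def lookup_mon_mult)
  qed (auto simp: scl_mult_left ring_distribs intro: closed)
  show "p * q \<in> deg_ge d"
  proof (induction q rule: FA_induct)
    case (mon w)
    show ?case using assms by (auto simp: deg_ge_def lookup_mult_mon)
  qed (auto simp: scl_mult_right ring_distribs intro: closed)
qed

lemma high_ideal_subset: "high_ideal j \<subseteq> deg_ge (Suc j)"
  unfolding high_ideal_def
proof (rule ring.genideal_minimal[OF ring_FA])
  show "ideal (deg_ge (Suc j)) FA"
    by (rule ideal_FA[OF subspace_deg_ge deg_ge_mult])
qed (auto simp: deg_ge_def lookup_mon)

lemma trunc_ideal_subset: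
  assumes "p \<in> trunc_ideal F j"
  shows "trunc j p \<in> rel_trunc (\<lambda>x. nc_deriv x F) j"
proof -
  obtain a b where ab: "a \<in> pot_ideal F" "b \<in> high_ideal j" "p = a + b"
    using assms unfolding trunc_ideal_def set_add_def' by auto
  have "trunc j b = 0"
    using ab(2) high_ideal_subset[of j] by (intro poly_mapping_eqI) (auto simp: lookup_trunc deg_ge_def)
  then show ?thesis using ab pot_ideal_subset[of F] by (auto simp: rel_trunc_def)
qed

lemma pot_ideal_trunc_ideal: "pot_ideal F \<subseteq> trunc_ideal F j"
  and high_ideal_trunc_ideal: "high_ideal j \<subseteq> trunc_ideal F j"
proof -
  have "0 \<in> high_ideal j" "0 \<in> pot_ideal F"
    using additive_subgroup.zero_closed[OF ideal.axioms(1)[OF ideal_high_ideal]]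
      additive_subgroup.zero_closed[OF ideal.axioms(1)[OF ideal_pot_ideal]] by auto
  then show "pot_ideal F \<subseteq> trunc_ideal F j" "high_ideal j \<subseteq> trunc_ideal F j"
    unfolding trunc_ideal_def set_add_def' by force+
qed

lemma pot_ideal_completion_subset: "pot_ideal_completion F \<subseteq> trunc_ideal F j"
  by (auto simp: pot_ideal_completion_def)

lemma trunc_diff_in_high_ideal: "p - trunc j p \<in> high_ideal j"
proof -
  interpret ideal "high_ideal j" FA by (rule ideal_high_ideal)
  have sub: "FA.subspace (high_ideal j)"
    using additive_subgroup.zero_closed[OF is_additive_subgroup]
      additive_subgroup.a_closed[OF is_additive_subgroup] I_l_closed
    by (auto simp: FA.subspace_def scl_def)
  have gen: "mon w \<in> high_ideal j" if "length w > j" for w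
    unfolding high_ideal_def by (rule subsetD[OF ring.genideal_self[OF ring_FA]]) (use that in auto)
  show ?thesis
  proof (induction p rule: FA_induct)
    case (add p q)
    have eq: "p + q - trunc j (p + q) = (p - trunc j p) + (q - trunc j q)" by simp
    show ?case unfolding eq by (rule FA.subspace_add[OF sub add])
  qed (auto simp: trunc_mon gen FA.subspace_0[OF sub] FA.subspace_scale[OF sub]
      simp flip: FA.scale_right_diff_distrib)
qed

context
  fixes F :: "('x::finite, 'k::field) free_alg" and k :: nat
  assumes F: "F \<in> potentials_from k" and k: "k \<ge> 2"
begin

text \<open>Truncating once more, to degree 0, would put 1 into \<open>rel_trunc\<close> at degree
  0, which vanishes because the relations have positive degree.\<close>

lemma one_notin_trunc_ideal: "1 \<notin> trunc_ideal F j"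
proof
  interpret potential_relations "\<lambda>x. nc_deriv x F" "k - 1"
    by (rule potential_relations_nc_deriv[OF F k])
  assume "1 \<in> trunc_ideal F j"
  then have "trunc j 1 \<in> rel_trunc (\<lambda>x. nc_deriv x F) j" by (rule trunc_ideal_subset)
  then obtain p where p: "p \<in> rel_ideal (\<lambda>x. nc_deriv x F)" "trunc j 1 = trunc j p"
    by (auto simp: rel_trunc_def)
  then have "trunc 0 p = trunc 0 (trunc j 1)" by simp
  also have "\<dots> = 1" by (simp add: trunc_mon flip: mon_Nil)
  finally have "1 \<in> rel_trunc (\<lambda>x. nc_deriv x F) 0" using p(1) by (auto simp: rel_trunc_def)
  then show False using rel_trunc_eq_0[OF d_pos] by simp
qed

lemma proper_trunc_ideal: "proper_ideal_FA (trunc_ideal F j)"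
  by (intro proper_ideal_FA.intro ideal_trunc_ideal proper_ideal_FA_axioms.intro one_notin_trunc_ideal)

lemma proper_pot_ideal_completion: "proper_ideal_FA (pot_ideal_completion F)"
  using one_notin_trunc_ideal pot_ideal_completion_subset
  by (intro proper_ideal_FA.intro ideal_pot_ideal_completion proper_ideal_FA_axioms.intro) blast

lemma proper_pot_ideal: "proper_ideal_FA (pot_ideal F)"
  using one_notin_trunc_ideal pot_ideal_trunc_ideal
  by (intro proper_ideal_FA.intro ideal_pot_ideal proper_ideal_FA_axioms.intro) blast

lemma obtain_words: obtains ws :: "'x list list"
  where "set ws = {w. length w \<le> j}" "low j = FA.span (set (map mon ws) :: ('x, 'k) free_alg set)"
  using finite_list[OF finite_words[of j]] low_eq_span by (metis list.set_map)

lemma carrier_pot_alg_trunc: "carrier (pot_alg_trunc F j) = (\<lambda>p. trunc_ideal F j +>\<^bsub>FA\<^esub> p) ` low j"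
proof -
  interpret T: proper_ideal_FA "trunc_ideal F j" by (rule proper_trunc_ideal)
  have "T.coset p = T.coset (trunc j p)" for p
    using T.coset_eq_iff trunc_diff_in_high_ideal high_ideal_trunc_ideal by blast
  then show ?thesis
    unfolding pot_alg_trunc_def T.carrier_Q using trunc_in_low by blast
qed

text \<open>Truncated representatives of a shortest spanning list of the quotient, together with a
  basis of \<open>rel_trunc\<close>, span \<open>low j\<close>. Upper bounds for the relations thus
  become lower bounds for the growth.\<close>

lemma words_le_growth_completion:
  "words_le TYPE('x) j \<le> growth_completion F j + FA.dim (rel_trunc (\<lambda>x. nc_deriv x F) j)"
proof -
  interpret T: proper_ideal_FA "trunc_ideal F j" by (rule proper_trunc_ideal)
  obtain ws :: "'x list list" where ws: "low j = FA.span (set (map mon ws) :: ('x, 'k) free_alg set)"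
    using obtain_words by metis
  obtain qs where qs: "length qs = growth_completion F j"
    "carrier (pot_alg_trunc F j) = T.coset ` FA.span (set qs)"
    using T.dim_coset_lift[of "carrier (pot_alg_trunc F j)" "map mon ws"] carrier_pot_alg_trunc ws
    unfolding growth_completion_def pot_alg_trunc_def by metis
  obtain B where B: "B \<subseteq> rel_trunc (\<lambda>x. nc_deriv x F) j" "FA.independent B"
    "rel_trunc (\<lambda>x. nc_deriv x F) j \<subseteq> FA.span B" "card B = FA.dim (rel_trunc (\<lambda>x. nc_deriv x F) j)"
    using FA.basis_exists by blast
  have finB: "finite B" by (rule finite_dim_low_card(1)[OF B(2) subset_trans[OF B(1) rel_trunc_low]])
  let ?S = "FA.span (trunc j ` set qs \<union> B)"
  have "low j \<subseteq> ?S"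
  proof
    fix p :: "('x, 'k) free_alg" assume p: "p \<in> low j"
    have "T.coset ` low j \<subseteq> T.coset ` FA.span (set qs)"
      using qs(2) carrier_pot_alg_trunc by simp
    then obtain s where s: "s \<in> FA.span (set qs)" "p - s \<in> trunc_ideal F j"
      using p unfolding T.coset_image_subset_iff by blast
    have "trunc j s \<in> ?S"
      by (rule span_linear_image[OF linear_trunc _ FA.subspace_span s(1)]) (auto intro: FA.span_base)
    moreover have "trunc j (p - s) \<in> ?S"
      using trunc_ideal_subset[OF s(2)] B(3) FA.span_mono[of B "trunc j ` set qs \<union> B"] by blast
    ultimately have "trunc j (p - s) + trunc j s \<in> ?S" by (rule FA.span_add[rotated])
    then show "p \<in> ?S" using trunc_low[OF p] by simp
  qed
  then have "words_le TYPE('x) j \<le> card (trunc j ` set qs \<union> B)"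
    using FA.dim_le_card[of "low j" "trunc j ` set qs \<union> B"] finB by (simp add: dim_low)
  also have "\<dots> \<le> card (trunc j ` set qs) + card B" by (rule card_Un_le)
  also have "\<dots> \<le> length qs + card B"
    by (simp add: le_trans[OF card_image_le card_length])
  finally show ?thesis using qs(1) B(4) by simp
qed

lemma growth_completion_le_length:
  assumes "\<And>p. \<exists>s\<in>FA.span (set qs). p - s \<in> trunc_ideal F j"
  shows "growth_completion F j \<le> length qs"
proof -
  interpret T: proper_ideal_FA "trunc_ideal F j" by (rule proper_trunc_ideal)
  obtain ws :: "'x list list" where ws: "low j = FA.span (set (map mon ws) :: ('x, 'k) free_alg set)"
    using obtain_words by metis
  have "carrier (pot_alg_trunc F j) \<subseteq> T.coset ` FA.span (set qs)"
    unfolding pot_alg_trunc_def T.carrier_Q T.coset_image_subset_iff using assms by blast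
  then show ?thesis
    using T.dim_coset_le[of "carrier (pot_alg_trunc F j)" "map mon ws" qs] carrier_pot_alg_trunc ws
    unfolding growth_completion_def pot_alg_trunc_def by metis
qed

text \<open>Representatives of a finite spanning set of the quotient by \<open>L\<close> would also
  span every truncated quotient and bound all their dimensions at once. One argument serves the
  ideal and its completion, as both lie in every \<open>trunc_ideal F j\<close>.\<close>

lemma infinite_dim_completionI:
  assumes "\<And>C. \<exists>j. growth_completion F j > C"
  shows "infinite_dim_pot_alg_completion F" "infinite_dim_pot_alg F"
proof -
  have key: "\<not> ring.finite_dimension (FA Quot L) (ground_field L) (carrier (FA Quot L))"
    if "proper_ideal_FA L" "\<And>j. L \<subseteq> trunc_ideal F j" for L
  proof
    interpret L: proper_ideal_FA L by fact
    assume "L.Q.finite_dimension (ground_field L) (carrier L.Q)"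
    then obtain n where "L.Q.dimension n (ground_field L) (carrier L.Q)" by blast
    from L.finite_dimension_lift[OF this] obtain qs where
      qs: "carrier L.Q = L.coset ` FA.span (set qs)" by blast
    have "\<exists>s\<in>FA.span (set qs). p - s \<in> L" for p
      using equalityD1[OF qs] unfolding L.carrier_Q L.coset_image_subset_iff by blast
    then have "growth_completion F j \<le> length qs" for j
      using that(2) by (intro growth_completion_le_length) blast
    then show False using assms[of "length qs"] by (meson not_le)
  qed
  show "infinite_dim_pot_alg_completion F"
    unfolding infinite_dim_pot_alg_completion_def pot_alg_completion_def
    by (rule key[OF proper_pot_ideal_completion pot_ideal_completion_subset])
  show "infinite_dim_pot_alg F"
    unfolding infinite_dim_pot_alg_def pot_alg_def
    by (rule key[OF proper_pot_ideal pot_ideal_trunc_ideal])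
qed

lemma low_span_eq: "low_span F j = (\<lambda>p. pot_ideal F +>\<^bsub>FA\<^esub> p) ` low j"
proof -
  interpret T: proper_ideal_FA "pot_ideal F" by (rule proper_pot_ideal)
  have span: "T.Q.Span (ground_field (pot_ideal F)) (map (\<lambda>w. T.coset (mon w)) ws) =
      T.coset ` FA.span (mon ` set ws)" for ws :: "'x list list"
    using T.Span_coset[of "map mon ws"] by (simp add: comp_def del: T.Q.Span.simps)
  have "low_span F j = (\<Union>ws\<in>{ws. \<forall>w\<in>set ws. length w \<le> j}. T.coset ` FA.span (mon ` set ws))"
    unfolding low_span_def pot_alg_def span by blast
  also have "\<dots> = T.coset ` low j"
  proof (intro equalityI UN_least)
    fix ws :: "'x list list" assume "ws \<in> {ws. \<forall>w\<in>set ws. length w \<le> j}"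
    then show "T.coset ` FA.span (mon ` set ws) \<subseteq> T.coset ` low j"
      unfolding low_eq_span by (intro image_mono FA.span_mono) auto
  next
    obtain ws :: "'x list list" where ws: "set ws = {w. length w \<le> j}"
      "low j = FA.span (set (map mon ws) :: ('x, 'k) free_alg set)"
      using obtain_words by metis
    then show "T.coset ` low j \<subseteq> (\<Union>ws\<in>{ws. \<forall>w\<in>set ws. length w \<le> j}. T.coset ` FA.span (mon ` set ws))"
      by (intro UN_upper[of ws, THEN subset_trans[rotated]]) auto
  qed
  finally show ?thesis .
qed

text \<open>Modulo monomials of degree above \<open>j\<close> every element equals its truncation,
  so the image of \<open>low j\<close> in the potential algebra maps onto the truncated algebra.
  This is why lower bounds are proved for the completion alone.\<close>

lemma growth_completion_le_growth: "growth_completion F j \<le> growth F j"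
proof -
  interpret T: proper_ideal_FA "pot_ideal F" by (rule proper_pot_ideal)
  obtain ws :: "'x list list" where ws: "low j = FA.span (set (map mon ws) :: ('x, 'k) free_alg set)"
    using obtain_words by metis
  obtain qs where qs: "length qs = growth F j" "low_span F j = T.coset ` FA.span (set qs)"
    using T.dim_coset_lift[of "low_span F j" "map mon ws"] low_span_eq ws
    unfolding growth_def pot_alg_def by metis
  have "\<exists>s\<in>FA.span (set qs). p - s \<in> trunc_ideal F j" for p
  proof -
    obtain s where s: "s \<in> FA.span (set qs)" "trunc j p - s \<in> pot_ideal F"
      using equalityD1[OF qs(2)] trunc_in_low[of j p]
      unfolding low_span_eq T.coset_image_subset_iff by blast
    interpret J: proper_ideal_FA "trunc_ideal F j" by (rule proper_trunc_ideal)
    have "(p - trunc j p) + (trunc j p - s) \<in> trunc_ideal F j"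
      by (rule J.add_closed)
        (use s(2) pot_ideal_trunc_ideal high_ideal_trunc_ideal trunc_diff_in_high_ideal in blast)+
    then show ?thesis using s(1) by auto
  qed
  then show ?thesis using growth_completion_le_length qs(1) by metis
qed

lemma growth_le_card:
  assumes "finite B" "\<And>p. p \<in> low j \<Longrightarrow> \<exists>s\<in>FA.span (mon ` B). p - s \<in> pot_ideal F"
  shows "growth F j \<le> card B"
proof -
  interpret T: proper_ideal_FA "pot_ideal F" by (rule proper_pot_ideal)
  obtain ws :: "'x list list" where ws: "low j = FA.span (set (map mon ws) :: ('x, 'k) free_alg set)"
    using obtain_words by metis
  obtain bs where bs: "set bs = B" "distinct bs" using finite_distinct_list[OF assms(1)] by blast
  have "low_span F j \<subseteq> T.coset ` FA.span (set (map mon bs))"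
    unfolding low_span_eq T.coset_image_subset_iff using assms(2) bs(1) by simp
  then have "growth F j \<le> length (map mon bs :: ('x, 'k) free_alg list)"
    using T.dim_coset_le[of "low_span F j" "map mon ws" "map mon bs"] low_span_eq ws
    unfolding growth_def pot_alg_def by metis
  then show ?thesis using bs distinct_card by fastforce
qed

end

section \<open>Normal words\<close>

definition avoiding :: "'x list set \<Rightarrow> 'x list set"
  where "avoiding Fb = {w. \<forall>f\<in>Fb. \<not> sublist f w}"

lemma Cons_avoiding_iff: "c # w \<in> avoiding Fb \<longleftrightarrow> w \<in> avoiding Fb \<and> (\<forall>f\<in>Fb. \<not> prefix f (c # w))"
  by (auto simp: avoiding_def sublist_Cons_right)

lemma Nil_avoiding_iff: "[] \<in> avoiding Fb \<longleftrightarrow> [] \<notin> Fb"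
  by (auto simp: avoiding_def)

text \<open>
  Any base would do: only the compatibility of the induced order on words of equal length with
  concatenation matters.
\<close>

fun word_value :: "('x \<Rightarrow> nat) \<Rightarrow> 'x list \<Rightarrow> nat" where
  "word_value v [] = 0"
| "word_value v (c # w) = v c * 3 ^ length w + word_value v w"

lemma word_value_append: "word_value v (u @ w) = word_value v u * 3 ^ length w + word_value v w"
  by (induction u) (auto simp: power_add algebra_simps)

text \<open>Replacing a forbidden factor lowers \<open>word_value\<close> and preserves the length,
  so rewriting terminates. Only spanning is claimed here; that the normal words of a reference
  potential are also independent modulo its ideal is a consequence of the dimension
  estimate.\<close>

lemma reduce_word:
  fixes I :: "('x, 'k::field) free_alg set"
  assumes I: "FA.subspace I" "\<And>p q. p \<in> I \<Longrightarrow> q * p \<in> I" "\<And>p q. p \<in> I \<Longrightarrow> p * q \<in> I"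
    and red: "\<And>f. f \<in> Fb \<Longrightarrow> \<exists>p\<in>FA.span (mon ` {w. length w = length f \<and> word_value v w < word_value v f}).
      mon f - p \<in> I"
  shows "\<exists>s\<in>FA.span (mon ` {u \<in> avoiding Fb. length u = length w}). mon w - s \<in> I"
proof (induction "word_value v w" arbitrary: w rule: less_induct)
  case less
  let ?N = "mon ` {u \<in> avoiding Fb. length u = length w} :: ('x, 'k) free_alg set"
  let ?V = "{q. \<exists>s\<in>FA.span ?N. q - s \<in> I}"
  have sub: "FA.subspace ?V"
  proof (rule FA.subspaceI)
    show "0 \<in> ?V" using FA.subspace_0[OF I(1)] FA.span_zero by (auto intro!: bexI[of _ 0])
    show "p + q \<in> ?V" if pq: "p \<in> ?V" "q \<in> ?V" for p q
    proof -
      obtain s t where st: "s \<in> FA.span ?N" "p - s \<in> I" "t \<in> FA.span ?N" "q - t \<in> I" using pq by blast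
      have "p + q - (s + t) = (p - s) + (q - t)" by simp
      then have "p + q - (s + t) \<in> I" using FA.subspace_add[OF I(1) st(2,4)] by metis
      then show ?thesis using FA.span_add[OF st(1,3)] by blast
    qed
    show "scl c p \<in> ?V" if p: "p \<in> ?V" for c p
    proof -
      obtain s where s: "s \<in> FA.span ?N" "p - s \<in> I" using p by blast
      have "scl c p - scl c s \<in> I"
        using FA.subspace_scale[OF I(1) s(2), of c] by (simp add: FA.scale_right_diff_distrib)
      then show ?thesis using FA.span_scale[OF s(1), of c] by blast
    qed
  qed
  show ?case
  proof (cases "w \<in> avoiding Fb")
    case True
    then show ?thesis
      using FA.subspace_0[OF I(1)] by (intro bexI[of _ "mon w"]) (auto intro: FA.span_base)
  next
    case False
    then obtain u f t where f: "f \<in> Fb" and w: "w = u @ f @ t"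
      by (auto simp: avoiding_def sublist_def)
    obtain p where p: "p \<in> FA.span (mon ` {w. length w = length f \<and> word_value v w < word_value v f})"
      "mon f - p \<in> I" using red[OF f] by blast
    have lin: "Vector_Spaces.linear scl scl (\<lambda>q. mon u * q * mon t)"
      by unfold_locales (auto simp: ring_distribs scl_mult_left scl_mult_right)
    have "mon u * p * mon t \<in> ?V"
    proof (rule span_linear_image[OF lin _ sub p(1)], rule image_subsetI)
      fix q :: "('x, 'k) free_alg"
      assume "q \<in> mon ` {w. length w = length f \<and> word_value v w < word_value v f}"
      then obtain w' where w': "q = mon w'" "length w' = length f" "word_value v w' < word_value v f" by blast
      have "word_value v (u @ w' @ t) < word_value v w"
        using w'(2,3) by (simp add: w word_value_append)
      from less(1)[OF this] show "mon u * q * mon t \<in> ?V"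
        using w'(1,2) by (simp add: w mon_mult)
    qed
    then obtain s where s: "s \<in> FA.span ?N" "mon u * p * mon t - s \<in> I" by blast
    have mem: "mon u * (mon f - p) * mon t \<in> I" using I(2,3) p(2) by blast
    have eq: "mon u * (mon f - p) * mon t = mon w - mon u * p * mon t"
      by (simp add: w ring_distribs mon_mult)
    have "(mon w - mon u * p * mon t) + (mon u * p * mon t - s) \<in> I"
      using FA.subspace_add[OF I(1) mem s(2)] unfolding eq .
    then have "mon w - s \<in> I" by simp
    then show ?thesis using s(1) by blast
  qed
qed

lemma reduce_low:
  fixes I :: "('x, 'k::field) free_alg set"
  assumes I: "FA.subspace I" "\<And>p q. p \<in> I \<Longrightarrow> q * p \<in> I" "\<And>p q. p \<in> I \<Longrightarrow> p * q \<in> I"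
    and red: "\<And>f. f \<in> Fb \<Longrightarrow> \<exists>p\<in>FA.span (mon ` {w. length w = length f \<and> word_value v w < word_value v f}).
      mon f - p \<in> I"
    and p: "p \<in> low j"
  shows "\<exists>s\<in>FA.span (mon ` {u \<in> avoiding Fb. length u \<le> j}). p - s \<in> I"
proof -
  let ?N = "mon ` {u \<in> avoiding Fb. length u \<le> j} :: ('x, 'k) free_alg set"
  have "\<exists>s\<in>FA.span ?N. mon w - s \<in> I" if "length w \<le> j" for w
  proof -
    obtain s where s: "s \<in> FA.span (mon ` {u \<in> avoiding Fb. length u = length w})" "mon w - s \<in> I"
      using reduce_word[OF I red] by blast
    have "FA.span (mon ` {u \<in> avoiding Fb. length u = length w}) \<subseteq> FA.span ?N"
      using that by (intro FA.span_mono) auto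
    with s show ?thesis by blast
  qed
  then have "\<forall>w\<in>{w. length w \<le> j}. \<exists>s. s \<in> FA.span ?N \<and> mon w - s \<in> I" by blast
  from bchoice[OF this] obtain h where h: "\<And>w. length w \<le> j \<Longrightarrow> h w \<in> FA.span ?N"
    "\<And>w. length w \<le> j \<Longrightarrow> mon w - h w \<in> I" by blast
  have le: "length w \<le> j" if "w \<in> Poly_Mapping.keys p" for w
    using p that by (auto simp: low_def in_keys_iff not_le[symmetric])
  let ?c = "Poly_Mapping.lookup p"
  let ?s = "\<Sum>w\<in>Poly_Mapping.keys p. scl (?c w) (h w)"
  have "?s \<in> FA.span ?N" by (intro FA.span_sum FA.span_scale h le)
  moreover have "(\<Sum>w\<in>Poly_Mapping.keys p. scl (?c w) (mon w - h w)) \<in> I"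
    by (intro FA.subspace_sum[OF I(1)] FA.subspace_scale[OF I(1)] h le)
  then have "(\<Sum>w\<in>Poly_Mapping.keys p. scl (?c w) (mon w)) - ?s \<in> I"
    by (simp add: FA.scale_right_diff_distrib sum_subtractf)
  then have "p - ?s \<in> I" by (simp flip: FA_expand)
  ultimately show ?thesis by blast
qed

lemma rel_ideal_subset_pot_ideal: "rel_ideal (\<lambda>x. nc_deriv x F) \<subseteq> pot_ideal F"
proof -
  interpret ideal "pot_ideal F" FA by (rule ideal_pot_ideal)
  have sub: "FA.subspace (pot_ideal F)"
    using additive_subgroup.zero_closed[OF is_additive_subgroup]
      additive_subgroup.a_closed[OF is_additive_subgroup] I_l_closed
    by (auto simp: FA.subspace_def scl_def)
  have gen: "nc_deriv x F \<in> pot_ideal F" for x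
    unfolding pot_ideal_def by (rule subsetD[OF ring.genideal_self[OF ring_FA]]) auto
  show ?thesis
    unfolding rel_ideal_def by (rule FA.span_minimal[OF _ sub]) (use I_l_closed I_r_closed gen in auto)
qed

text \<open>
  A potential \<open>G\<close> whose algebra is spanned by the words avoiding \<open>Fb\<close>, where this set of words
  has the generating function \<open>(1 - n t + n t\<^bsup>k-1\<^esup> - t\<^sup>k)\<^sup>-\<^sup>1\<close>, bounds the growth for all other potentials.
\<close>

locale reference_potential =
  fixes G :: "('x::finite, 'k::field) free_alg" and k :: nat and Fb :: "'x list set"
    and x0 :: 'x and v :: "'x \<Rightarrow> nat" and \<beta> :: "nat \<Rightarrow> nat"
  assumes G: "G \<in> potentials_from k" and k: "k \<ge> 2"
    and red: "\<And>f. f \<in> Fb \<Longrightarrow> \<exists>p\<in>FA.span (mon ` {w. length w = length f \<and> word_value v w < word_value v f}).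
      mon f - p \<in> rel_ideal (\<lambda>x. nc_deriv x G)"
    and x0: "\<And>f. f \<in> Fb \<Longrightarrow> f \<noteq> [] \<and> hd f \<noteq> x0"
    and \<beta>: "\<And>j. \<beta> j = card {w \<in> avoiding Fb. length w \<le> j}"
    and rec0: "\<beta> (k - 1) + CARD('x) * \<beta> 0 \<le> 1 + CARD('x) * \<beta> (k - 2)"
    and rec: "\<And>m. \<beta> (m + k) + CARD('x) * \<beta> (Suc m) \<le> 1 + CARD('x) * \<beta> (m + (k - 1)) + \<beta> m"
begin

lemma normal_span:
  "p \<in> low j \<Longrightarrow> \<exists>s\<in>FA.span (mon ` {u \<in> avoiding Fb. length u \<le> j}). p - s \<in> rel_ideal (\<lambda>x. nc_deriv x G)"
  by (rule reduce_low[OF subspace_rel_ideal rel_ideal_mult_left rel_ideal_mult_right red])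

lemma beta_le_growth_completion:
  assumes F: "F \<in> (potentials_from k :: ('x, 'k) free_alg set)"
  shows "\<beta> j \<le> growth_completion F j"
proof -
  have sp: "low m \<subseteq> FA.span (mon ` {w \<in> avoiding Fb. length w \<le> m} \<union> rel_trunc (\<lambda>x. nc_deriv x G) m)"
    (is "_ \<subseteq> FA.span (?N \<union> ?R)") for m
  proof
    fix p :: "('x, 'k) free_alg" assume p: "p \<in> low m"
    then obtain s where s: "s \<in> FA.span ?N" "p - s \<in> rel_ideal (\<lambda>x. nc_deriv x G)"
      using normal_span by blast
    have "?N \<subseteq> mon ` {w. length w \<le> m}" by blast
    then have "FA.span ?N \<subseteq> low m" unfolding low_eq_span by (rule FA.span_mono)
    \<comment> \<open>Reduction does not raise the degree, so \<open>p - s\<close> has degree at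
      most \<open>m\<close> and is its own truncation: it lies in \<open>rel_trunc\<close>, not
      merely in the ideal.\<close>
    then have "trunc m (p - s) = p - s"
      by (intro trunc_low FA.subspace_diff[OF subspace_low] p) (use s(1) in blast)
    then have "p - s \<in> ?R" using s(2) by (metis imageI rel_trunc_def)
    then have "p - s \<in> FA.span (?N \<union> ?R)" by (intro FA.span_base) blast
    moreover have "s \<in> FA.span (?N \<union> ?R)" using s(1) FA.span_mono[of ?N "?N \<union> ?R"] by blast
    ultimately have "(p - s) + s \<in> FA.span (?N \<union> ?R)" by (rule FA.span_add)
    then show "p \<in> FA.span (?N \<union> ?R)" by simp
  qed
  have k1: "Suc m + (k - 1) = m + k" "k - 1 - 1 = k - 2" for m using k by auto
  have "\<beta> j + FA.dim (rel_trunc (\<lambda>x. nc_deriv x F) j) \<le> words_le TYPE('x) j"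
    unfolding \<beta>
  proof (rule good_potential_bound[OF potential_relations_nc_deriv[OF F k] potential_relations_nc_deriv[OF G k] _ sp])
    show "x0 # w \<in> avoiding Fb" if "w \<in> avoiding Fb" for w
      using that by (auto simp: Cons_avoiding_iff prefix_Cons dest: x0)
  qed (use rec0 rec in \<open>simp_all only: k1 \<beta>[symmetric]\<close>)
  also have "\<dots> \<le> growth_completion F j + FA.dim (rel_trunc (\<lambda>x. nc_deriv x F) j)"
    by (rule words_le_growth_completion[OF F k])
  finally show ?thesis by simp
qed

text \<open>Combined with \<open>beta_le_growth_completion\<close> for \<open>G\<close> itself, this
  forces both growth functions of \<open>G\<close> to equal \<beta>.\<close>

lemma growth_reference_le: "growth G j \<le> \<beta> j"
  unfolding \<beta>
proof (rule growth_le_card[OF G k])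
  show "finite {w \<in> avoiding Fb. length w \<le> j}"
    by (rule finite_subset[OF _ finite_words[of j]]) auto
qed (use normal_span rel_ideal_subset_pot_ideal in blast)

end

section \<open>Counting normal words\<close>

lemma finite_avoiding: "finite {w \<in> avoiding Fb. length w \<le> j \<and> P (w :: 'x::finite list)}"
  by (rule finite_subset[OF _ finite_words[of j]]) auto

text \<open>For x < y the two forbidden words are the leading words of the derivatives by y and by x
  of the cyclic sum of x^(e+1) y^2, a potential of degree k = e + 3. So \<open>e\<close> is 1 for k
  = 4 and 2 for k = 5.\<close>

context
  fixes x y :: "'x::finite" and e :: nat and Fb :: "'x list set" and \<beta> :: "nat \<Rightarrow> nat"
  assumes xy: "x \<noteq> y" and UNIV: "(UNIV :: 'x set) = {x, y}" and e: "e \<ge> 1"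
  defines "Fb \<equiv> {y # replicate (Suc e) x, y # y # replicate e x}"
    and "\<beta> j \<equiv> card {w \<in> avoiding Fb. length w \<le> j}"
begin

lemma avoiding2_Cons:
  "x # w \<in> avoiding Fb \<longleftrightarrow> w \<in> avoiding Fb"
  "y # w \<in> avoiding Fb \<longleftrightarrow> w \<in> avoiding Fb \<and> \<not> prefix (replicate (Suc e) x) w \<and> \<not> prefix (y # replicate e x) w"
  using xy by (auto simp: Cons_avoiding_iff Fb_def)

lemma avoiding2_replicate: "replicate i x @ w \<in> avoiding Fb \<longleftrightarrow> w \<in> avoiding Fb"
  by (induction i) (auto simp: avoiding2_Cons)

text \<open>The word \<open>y # replicate e x\<close> becomes forbidden exactly when one more
  \<open>x\<close> follows. The other forbidden word cannot start at this \<open>y\<close>, because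
  \<open>e \<ge> 1\<close> puts an \<open>x\<close> directly behind it.\<close>

lemma avoiding2_prefix: "y # replicate e x @ w \<in> avoiding Fb \<longleftrightarrow> w \<in> avoiding Fb \<and> \<not> prefix [x] w"
proof -
  have "replicate (Suc e) x = replicate e x @ [x]" by (simp add: replicate_append_same)
  then have "prefix (replicate (Suc e) x) (replicate e x @ w) \<longleftrightarrow> prefix [x] w"
    by (simp only: same_prefix_prefix)
  moreover have "\<not> prefix (y # replicate e x) (replicate e x @ w)"
    using e xy by (cases e) auto
  ultimately show ?thesis by (simp add: avoiding2_Cons avoiding2_replicate del: replicate_Suc)
qed

lemma beta2_0: "\<beta> 0 = 1"
proof -
  have "{w \<in> avoiding Fb. length w \<le> 0} = {[]}" by (auto simp: Nil_avoiding_iff Fb_def)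
  then show ?thesis by (simp add: \<beta>_def)
qed

lemma beta2_prefix_x: "card {w \<in> avoiding Fb. length w \<le> Suc j \<and> prefix [x] w} = \<beta> j"
proof -
  have "{w \<in> avoiding Fb. length w \<le> Suc j \<and> prefix [x] w} = (#) x ` {w \<in> avoiding Fb. length w \<le> j}"
    by (auto simp: prefix_Cons avoiding2_Cons image_iff prefix_def)
  then show ?thesis by (simp add: \<beta>_def card_image)
qed

text \<open>Splitting off the first letter: behind \<open>x\<close> any normal word may stand,
  behind \<open>y\<close> only one with neither of the two prefixes. These prefixes begin with
  different letters, so the excluded sets are disjoint and their sizes just add up.\<close>

lemma beta2_Suc:
  "\<beta> (Suc j) + card {w \<in> avoiding Fb. length w \<le> j \<and> prefix (replicate (Suc e) x) w}
    + card {w \<in> avoiding Fb. length w \<le> j \<and> prefix (y # replicate e x) w} = 1 + 2 * \<beta> j"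
proof -
  let ?A = "{w \<in> avoiding Fb. length w \<le> j}"
  let ?P1 = "{w \<in> avoiding Fb. length w \<le> j \<and> prefix (replicate (Suc e) x) w}"
  let ?P2 = "{w \<in> avoiding Fb. length w \<le> j \<and> prefix (y # replicate e x) w}"
  have finA: "finite ?A" using finite_avoiding[of Fb j "\<lambda>_. True"] by simp
  have eq: "{w \<in> avoiding Fb. length w \<le> Suc j} = {[]} \<union> ((#) x ` ?A \<union> (#) y ` (?A - (?P1 \<union> ?P2)))"
  proof (rule Set.set_eqI)
    fix w
    show "w \<in> {w \<in> avoiding Fb. length w \<le> Suc j} \<longleftrightarrow>
      w \<in> {[]} \<union> ((#) x ` ?A \<union> (#) y ` (?A - (?P1 \<union> ?P2)))"
    proof (cases w)
      case Nil
      then show ?thesis by (auto simp: Nil_avoiding_iff Fb_def)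
    next
      case (Cons c t)
      have "c = x \<or> c = y" using UNIV by blast
      then show ?thesis using Cons xy by (auto simp: avoiding2_Cons image_iff simp del: replicate_Suc)
    qed
  qed
  have "card {w \<in> avoiding Fb. length w \<le> Suc j} = 1 + (card ?A + card (?A - (?P1 \<union> ?P2)))"
    unfolding eq using xy finA
    by (subst card_Un_disjoint, simp, simp, blast, subst card_Un_disjoint) (auto simp: card_image)
  moreover have "card (?A - (?P1 \<union> ?P2)) + card (?P1 \<union> ?P2) = card ?A"
  proof -
    have "?P1 \<union> ?P2 \<subseteq> ?A" by blast
    then show ?thesis using card_Diff_subset[OF finite_subset[OF _ finA]] card_mono[OF finA]
      by (metis (no_types, lifting) le_add_diff_inverse2)
  qed
  moreover have "card (?P1 \<union> ?P2) = card ?P1 + card ?P2"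
    by (rule card_Un_disjoint) (use xy finite_avoiding in \<open>auto simp: prefix_def\<close>)
  ultimately show ?thesis unfolding \<beta>_def by linarith
qed

lemma beta2_small: "j \<le> e \<Longrightarrow> \<beta> (Suc j) = 1 + 2 * \<beta> j"
proof -
  assume "j \<le> e"
  then have "{w \<in> avoiding Fb. length w \<le> j \<and> prefix (replicate (Suc e) x) w} = {}"
    "{w \<in> avoiding Fb. length w \<le> j \<and> prefix (y # replicate e x) w} = {}"
    by (auto dest!: prefix_length_le)
  then show ?thesis using beta2_Suc[of j] by (simp only: card.empty)
qed

lemma beta2_rec:
  "\<beta> (m + e + 2) + \<beta> m + card {w \<in> avoiding Fb. length w \<le> m \<and> \<not> prefix [x] w} = 1 + 2 * \<beta> (m + e + 1)"
proof -
  have "{w \<in> avoiding Fb. length w \<le> m + e + 1 \<and> prefix (replicate (Suc e) x) w} =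
      (@) (replicate (Suc e) x) ` {w \<in> avoiding Fb. length w \<le> m}"
    by (auto simp: prefix_def avoiding2_replicate image_iff simp del: replicate_Suc)
  then have 1: "card {w \<in> avoiding Fb. length w \<le> m + e + 1 \<and> prefix (replicate (Suc e) x) w} = \<beta> m"
    unfolding \<beta>_def by (simp add: card_image inj_on_def del: replicate_Suc)
  have "{w \<in> avoiding Fb. length w \<le> m + e + 1 \<and> prefix (y # replicate e x) w} =
      (@) (y # replicate e x) ` {w \<in> avoiding Fb. length w \<le> m \<and> \<not> prefix [x] w}"
    by (auto simp: avoiding2_prefix image_iff elim!: prefixE)
  then have 2: "card {w \<in> avoiding Fb. length w \<le> m + e + 1 \<and> prefix (y # replicate e x) w} =
      card {w \<in> avoiding Fb. length w \<le> m \<and> \<not> prefix [x] w}"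
    by (simp add: card_image inj_on_def)
  show ?thesis using beta2_Suc[of "m + e + 1"] unfolding 1 2 by simp
qed

lemma beta2_rec_0: "\<beta> (e + 2) + 2 * \<beta> 0 = 1 + 2 * \<beta> (e + 1)"
proof -
  have "{w \<in> avoiding Fb. length w \<le> 0 \<and> \<not> prefix [x] w} = {[]}"
    by (auto simp: Nil_avoiding_iff Fb_def)
  then show ?thesis using beta2_rec[of 0] by (simp add: beta2_0)
qed

text \<open>The normal words of length at most \<open>Suc m\<close> that begin with \<open>x\<close>
  number \<open>\<beta> m\<close>, by removing that letter. Subtracting them eliminates the
  auxiliary count of \<open>beta2_rec\<close> and yields \<open>rec\<close> with equality, for k = e
  + 3.\<close>

lemma beta2_rec_Suc: "\<beta> (m + e + 3) + 2 * \<beta> (Suc m) = 1 + 2 * \<beta> (m + e + 2) + \<beta> m"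
proof -
  have "{w \<in> avoiding Fb. length w \<le> Suc m} = {w \<in> avoiding Fb. length w \<le> Suc m \<and> prefix [x] w} \<union>
      {w \<in> avoiding Fb. length w \<le> Suc m \<and> \<not> prefix [x] w}" by blast
  also have "card \<dots> = card {w \<in> avoiding Fb. length w \<le> Suc m \<and> prefix [x] w} +
      card {w \<in> avoiding Fb. length w \<le> Suc m \<and> \<not> prefix [x] w}"
    by (rule card_Un_disjoint[OF finite_avoiding finite_avoiding]) blast
  finally have "\<beta> (Suc m) = \<beta> m + card {w \<in> avoiding Fb. length w \<le> Suc m \<and> \<not> prefix [x] w}"
    unfolding beta2_prefix_x \<beta>_def[of "Suc m"] .
  then show ?thesis using beta2_rec[of "Suc m"] by (simp add: numeral_3_eq_3)
qed

end

text \<open>The normal words are the sorted words x^a y^b z^c. They are the monomials of the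
  commutative polynomial ring in three variables, which is the algebra of the reference potential
  for n = k = 3.\<close>

context
  fixes x y z :: "'x::finite" and Fb :: "'x list set" and \<beta> :: "nat \<Rightarrow> nat"
  assumes xyz: "x \<noteq> y" "x \<noteq> z" "y \<noteq> z" and UNIV: "(UNIV :: 'x set) = {x, y, z}"
  defines "Fb \<equiv> {[y, x], [z, x], [z, y]}"
    and "\<beta> j \<equiv> card {w \<in> avoiding Fb. length w \<le> j}"
begin

lemma avoiding3_Cons:
  "x # w \<in> avoiding Fb \<longleftrightarrow> w \<in> avoiding Fb"
  "y # w \<in> avoiding Fb \<longleftrightarrow> w \<in> avoiding Fb \<and> \<not> prefix [x] w"
  "z # w \<in> avoiding Fb \<longleftrightarrow> w \<in> avoiding Fb \<and> \<not> prefix [x] w \<and> \<not> prefix [y] w"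
  using xyz by (auto simp: Cons_avoiding_iff Fb_def)

text \<open>\<open>P\<close> says that a word does not begin with a letter smaller than
  \<open>c\<close>, and \<open>P'\<close> excludes \<open>c\<close> as well. Used for x, y and z in
  turn, this gives three nested recursions of Pascal type.\<close>

lemma card_avoiding_Cons:
  assumes A: "\<And>w. c # w \<in> avoiding Fb \<longleftrightarrow> w \<in> avoiding Fb \<and> P w"
    and P': "\<And>w. P' w \<longleftrightarrow> P w \<and> \<not> prefix [c] w" and P: "\<And>w. P (c # w)" "P []"
  shows "card {w \<in> avoiding Fb. length w \<le> Suc j \<and> P w} =
    card {w \<in> avoiding Fb. length w \<le> Suc j \<and> P' w} + card {w \<in> avoiding Fb. length w \<le> j \<and> P w}"
proof -
  have "{w \<in> avoiding Fb. length w \<le> Suc j \<and> P w} =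
      {w \<in> avoiding Fb. length w \<le> Suc j \<and> P' w} \<union> (#) c ` {w \<in> avoiding Fb. length w \<le> j \<and> P w}"
  proof (rule Set.set_eqI)
    fix w
    show "w \<in> {w \<in> avoiding Fb. length w \<le> Suc j \<and> P w} \<longleftrightarrow>
      w \<in> {w \<in> avoiding Fb. length w \<le> Suc j \<and> P' w} \<union> (#) c ` {w \<in> avoiding Fb. length w \<le> j \<and> P w}"
    proof (cases w)
      case Nil
      then show ?thesis by (simp add: P' P image_iff)
    next
      case (Cons a t)
      show ?thesis
      proof (cases "a = c")
        case True
        then show ?thesis by (auto simp: Cons P' P A)
      next
        case False
        then show ?thesis by (simp add: Cons P' image_iff)
      qed
    qed
  qed
  also have "card \<dots> = card {w \<in> avoiding Fb. length w \<le> Suc j \<and> P' w} +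
      card ((#) c ` {w \<in> avoiding Fb. length w \<le> j \<and> P w})"
    by (rule card_Un_disjoint[OF finite_avoiding finite_imageI[OF finite_avoiding]])
      (auto simp: P')
  finally show ?thesis by (simp add: card_image)
qed

lemma beta3_closed_form: "6 * \<beta> j = (j + 1) * (j + 2) * (j + 3)"
proof -
  \<comment> \<open>A normal word not beginning with \<open>x\<close> is a sorted word in
    \<open>y\<close> and \<open>z\<close>; one beginning with neither \<open>x\<close> nor
    \<open>y\<close> is a power of \<open>z\<close>.\<close>
  define \<gamma> where "\<gamma> j = card {w \<in> avoiding Fb. length w \<le> j \<and> \<not> prefix [x] w}" for j
  define \<delta> where "\<delta> j = card {w \<in> avoiding Fb. length w \<le> j \<and> (\<not> prefix [x] w \<and> \<not> prefix [y] w)}" for j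
  have "\<beta> (Suc j) = \<gamma> (Suc j) + \<beta> j" for j
    using card_avoiding_Cons[of x "\<lambda>_. True" "\<lambda>w. \<not> prefix [x] w" j]
    by (simp add: avoiding3_Cons \<beta>_def \<gamma>_def)
  moreover have "\<gamma> (Suc j) = \<delta> (Suc j) + \<gamma> j" for j
    using card_avoiding_Cons[of y "\<lambda>w. \<not> prefix [x] w" "\<lambda>w. \<not> prefix [x] w \<and> \<not> prefix [y] w" j]
    xyz by (simp add: avoiding3_Cons \<gamma>_def \<delta>_def)
  moreover have "\<delta> (Suc j) = 1 + \<delta> j" for j
  proof -
    have "{w \<in> avoiding Fb. length w \<le> Suc j \<and>
      (\<not> prefix [x] w \<and> \<not> prefix [y] w) \<and> \<not> prefix [z] w} = {[]}" (is "?E = _")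
    proof -
      have "w \<in> ?E \<longleftrightarrow> w = []" for w
      proof (cases w)
        case (Cons c t)
        have "c = x \<or> c = y \<or> c = z" using UNIV by blast
        then show ?thesis using Cons by auto
      qed (simp add: Nil_avoiding_iff Fb_def)
      then show ?thesis by blast
    qed
    then show ?thesis
      using card_avoiding_Cons[of z "\<lambda>w. \<not> prefix [x] w \<and> \<not> prefix [y] w" _ j, OF _ refl]
      xyz by (simp add: avoiding3_Cons \<delta>_def)
  qed
  moreover have "\<beta> 0 = 1" "\<gamma> 0 = 1" "\<delta> 0 = 1"
  proof -
    have "{w \<in> avoiding Fb. length w \<le> 0 \<and> P w} = {[]}" if "P []" for P
      using that by (auto simp: Nil_avoiding_iff Fb_def)
    from this[of "\<lambda>_. True"] this[of "\<lambda>w. \<not> prefix [x] w"]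
      this[of "\<lambda>w. \<not> prefix [x] w \<and> \<not> prefix [y] w"]
    show "\<beta> 0 = 1" "\<gamma> 0 = 1" "\<delta> 0 = 1" by (simp_all add: \<beta>_def \<gamma>_def \<delta>_def)
  qed
  ultimately have "\<delta> j = j + 1 \<and> 2 * \<gamma> j = (j + 1) * (j + 2) \<and> 6 * \<beta> j = (j + 1) * (j + 2) * (j + 3)" for j
    by (induction j) (simp_all add: algebra_simps)
  then show ?thesis by blast
qed

end

section \<open>Reference potentials\<close>

lemma lin_ext_diff [simp]: "lin_ext f (p - q) = lin_ext f p - lin_ext f q"
  by (metis add_diff_cancel diff_add_cancel lin_ext_add)

lemma nc_deriv_in_rel_ideal: "nc_deriv x F \<in> rel_ideal (\<lambda>x. nc_deriv x F)"
  using rel_in_rel_ideal[of "\<lambda>x. nc_deriv x F"] .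

lemma lookup_mon_shorter: "length w < length u \<Longrightarrow> Poly_Mapping.lookup (mon u) w = 0"
  by (auto simp: lookup_mon)

lemma mon_in_span: "P w \<Longrightarrow> mon w \<in> FA.span (mon ` {w. P w})"
  by (rule FA.span_base) auto

lemma reduction_exists_2:
  assumes "nc_deriv x F = mon f + mon w"
    and "length w = length f" "word_value v w < word_value v f"
  shows "\<exists>p\<in>FA.span (mon ` {w. length w = length f \<and> word_value v w < word_value v f}).
    mon f - p \<in> rel_ideal (\<lambda>x. nc_deriv x F)"
proof -
  have "mon f - (- mon w) = nc_deriv x F" using assms(1) by simp
  then show ?thesis
    using assms(2,3) nc_deriv_in_rel_ideal by (metis (mono_tags, lifting) FA.span_neg mon_in_span)
qed

text \<open>The four rotations of \<open>[x, x, y, y]\<close> are distinct, so each enters with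
  coefficient 1 and the derivatives keep their leading words in every characteristic.\<close>

lemma reference_potential_2_4:
  assumes xy: "x \<noteq> y" and U: "(UNIV :: 'x::finite set) = {x, y}"
  shows "reference_potential (mon [x, x, y, y] + mon [x, y, y, x] + mon [y, y, x, x] + mon [y, x, x, y] :: ('x, 'k::field) free_alg)
    4 {y # replicate (Suc 1) x, y # y # replicate 1 x} x (\<lambda>c. if c = x then 0 else 1)
    (\<lambda>j. card {w \<in> avoiding {y # replicate (Suc 1) x, y # y # replicate 1 x}. length w \<le> j})"
    (is "reference_potential ?G 4 ?Fb x ?v ?\<beta>")
proof
  have C: "CARD('x) = 2" using xy by (simp add: U)
  show "?G \<in> potentials_from 4"
    unfolding potentials_from_iff
    by (rule conjI, simp add: cyc_rot_def add_ac, simp add: lookup_add lookup_mon_shorter)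
  have d: "nc_deriv y ?G = mon [y, x, x] + mon [x, x, y]" "nc_deriv x ?G = mon [y, y, x] + mon [x, y, y]"
    using xy by (simp_all add: nc_deriv_def add_ac)
  fix f assume f: "f \<in> ?Fb"
  then consider "f = [y, x, x]" | "f = [y, y, x]" by auto
  then show "\<exists>p\<in>FA.span (mon ` {w. length w = length f \<and> word_value ?v w < word_value ?v f}).
      mon f - p \<in> rel_ideal (\<lambda>x. nc_deriv x ?G)"
  proof cases
    case 1
    then show ?thesis by (intro reduction_exists_2[of y _ _ "[x, x, y]"]) (use xy d in auto)
  next
    case 2
    then show ?thesis by (intro reduction_exists_2[of x _ _ "[x, y, y]"]) (use xy d in auto)
  qed
  show "f \<noteq> [] \<and> hd f \<noteq> x" using f xy by auto
next
  have C: "CARD('x) = 2" using xy by (simp add: U)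
  show "?\<beta> (4 - 1) + CARD('x) * ?\<beta> 0 \<le> 1 + CARD('x) * ?\<beta> (4 - 2)"
    using beta2_rec_0[OF xy U, of 1] by (simp add: C numeral_eq_Suc)
  show "?\<beta> (m + 4) + CARD('x) * ?\<beta> (Suc m) \<le> 1 + CARD('x) * ?\<beta> (m + (4 - 1)) + ?\<beta> m" for m
    using beta2_rec_Suc[OF xy U, of 1 m] by (simp add: C numeral_eq_Suc)
qed auto

lemma reference_potential_2_5:
  assumes xy: "x \<noteq> y" and U: "(UNIV :: 'x::finite set) = {x, y}"
  shows "reference_potential
    (mon [x, x, x, y, y] + mon [x, x, y, y, x] + mon [x, y, y, x, x] + mon [y, y, x, x, x] + mon [y, x, x, x, y]
      :: ('x, 'k::field) free_alg)
    5 {y # replicate (Suc 2) x, y # y # replicate 2 x} x (\<lambda>c. if c = x then 0 else 1)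
    (\<lambda>j. card {w \<in> avoiding {y # replicate (Suc 2) x, y # y # replicate 2 x}. length w \<le> j})"
    (is "reference_potential ?G 5 ?Fb x ?v ?\<beta>")
proof
  show "?G \<in> potentials_from 5"
    unfolding potentials_from_iff
    by (rule conjI, simp add: cyc_rot_def add_ac, simp add: lookup_add lookup_mon_shorter)
  have d: "nc_deriv y ?G = mon [y, x, x, x] + mon [x, x, x, y]"
    "nc_deriv x ?G = mon [y, y, x, x] + (mon [x, y, y, x] + mon [x, x, y, y])"
    using xy by (simp_all add: nc_deriv_def add_ac)
  fix f assume f: "f \<in> ?Fb"
  then consider "f = [y, x, x, x]" | "f = [y, y, x, x]" by (auto simp: numeral_2_eq_2)
  then show "\<exists>p\<in>FA.span (mon ` {w. length w = length f \<and> word_value ?v w < word_value ?v f}).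
      mon f - p \<in> rel_ideal (\<lambda>x. nc_deriv x ?G)"
  proof cases
    case 1
    then show ?thesis
      by (intro reduction_exists_2[of y _ _ "[x, x, x, y]"]) (use xy d in auto)
  next
    case 2
    let ?S = "{w. length w = length f \<and> word_value ?v w < word_value ?v f}"
    have "- (mon [x, y, y, x] + mon [x, x, y, y]) \<in> FA.span (mon ` ?S)"
      by (intro FA.span_neg FA.span_add mon_in_span) (use xy 2 in auto)
    moreover have "mon f - - (mon [x, y, y, x] + mon [x, x, y, y]) \<in> rel_ideal (\<lambda>x. nc_deriv x ?G)"
      using nc_deriv_in_rel_ideal[of x ?G] unfolding d(2) 2 by (simp only: diff_minus_eq_add)
    ultimately show ?thesis by blast
  qed
  show "f \<noteq> [] \<and> hd f \<noteq> x" using f xy by auto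
next
  have C: "CARD('x) = 2" using xy by (simp add: U)
  show "?\<beta> (5 - 1) + CARD('x) * ?\<beta> 0 \<le> 1 + CARD('x) * ?\<beta> (5 - 2)"
    using beta2_rec_0[OF xy U, of 2] by (simp add: C numeral_eq_Suc)
  show "?\<beta> (m + 5) + CARD('x) * ?\<beta> (Suc m) \<le> 1 + CARD('x) * ?\<beta> (m + (5 - 1)) + ?\<beta> m" for m
    using beta2_rec_Suc[OF xy U, of 2 m] by (simp add: C numeral_eq_Suc)
qed auto

lemma reference_potential_3_3:
  assumes xyz: "x \<noteq> y" "x \<noteq> z" "y \<noteq> z" and U: "(UNIV :: 'x::finite set) = {x, y, z}"
  shows "reference_potential
    (mon [x, y, z] + mon [y, z, x] + mon [z, x, y] - (mon [x, z, y] + mon [z, y, x] + mon [y, x, z])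
      :: ('x, 'k::field) free_alg)
    3 {[y, x], [z, x], [z, y]} x (\<lambda>c. if c = x then 0 else if c = y then 1 else 2)
    (\<lambda>j. card {w \<in> avoiding {[y, x], [z, x], [z, y]}. length w \<le> j})"
    (is "reference_potential ?G 3 ?Fb x ?v ?\<beta>")
proof
  show "?G \<in> potentials_from 3"
    unfolding potentials_from_iff
    by (rule conjI, simp add: cyc_rot_def add_ac, simp add: lookup_add lookup_minus lookup_mon_shorter)
  have d: "nc_deriv x ?G = mon [y, z] - mon [z, y]" "nc_deriv y ?G = mon [z, x] - mon [x, z]"
    "nc_deriv z ?G = mon [x, y] - mon [y, x]"
    using xyz by (simp_all add: nc_deriv_def)
  let ?I = "rel_ideal (\<lambda>x. nc_deriv x ?G)"
  \<comment> \<open>The derivatives are commutators; the signs are adjusted so that the larger word,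
    the forbidden one, has coefficient 1.\<close>
  have "- nc_deriv x ?G \<in> ?I" "nc_deriv y ?G \<in> ?I" "- nc_deriv z ?G \<in> ?I"
    by (intro FA.subspace_neg[OF subspace_rel_ideal] nc_deriv_in_rel_ideal)+
  then have I: "mon [z, y] - mon [y, z] \<in> ?I" "mon [z, x] - mon [x, z] \<in> ?I" "mon [y, x] - mon [x, y] \<in> ?I"
    unfolding d by simp_all
  fix f assume f: "f \<in> ?Fb"
  then consider "f = [y, x]" | "f = [z, x]" | "f = [z, y]" by auto
  then show "\<exists>p\<in>FA.span (mon ` {w. length w = length f \<and> word_value ?v w < word_value ?v f}). mon f - p \<in> ?I"
  proof cases
    case 1
    then show ?thesis using I(3) xyz by (intro bexI[of _ "mon [x, y]"] mon_in_span) auto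
  next
    case 2
    then show ?thesis using I(2) xyz by (intro bexI[of _ "mon [x, z]"] mon_in_span) auto
  next
    case 3
    then show ?thesis using I(1) xyz by (intro bexI[of _ "mon [y, z]"] mon_in_span) auto
  qed
  show "f \<noteq> [] \<and> hd f \<noteq> x" using f xyz by auto
next
  have C: "CARD('x) = 3" using xyz by (simp add: U)
  note cf = beta3_closed_form[OF xyz U]
  have "6 * (?\<beta> (3 - 1) + 3 * ?\<beta> 0) \<le> 6 * (1 + 3 * ?\<beta> (3 - 2))"
    unfolding distrib_left mult.left_commute[of 6 3] cf by simp
  then show "?\<beta> (3 - 1) + CARD('x) * ?\<beta> 0 \<le> 1 + CARD('x) * ?\<beta> (3 - 2)" by (simp add: C)
  have six: "6 * (?\<beta> (m + 3) + 3 * ?\<beta> (Suc m)) \<le> 6 * (1 + 3 * ?\<beta> (m + 2) + ?\<beta> m)" for m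
    unfolding distrib_left mult.left_commute[of 6 3] cf by (simp add: algebra_simps)
  have "?\<beta> (m + 3) + 3 * ?\<beta> (Suc m) \<le> 1 + 3 * ?\<beta> (m + 2) + ?\<beta> m" for m
    by (rule iffD1[OF nat_mult_le_cancel1 six]) simp
  then show "?\<beta> (m + 3) + CARD('x) * ?\<beta> (Suc m) \<le> 1 + CARD('x) * ?\<beta> (m + (3 - 1)) + ?\<beta> m" for m
    by (simp add: C)
qed auto

section \<open>Growth rates\<close>

text \<open>The constants 12 and 10 are dictated by the case n = 2, k = 4 and shared, so that both
  cubic cases end in the same bounds.\<close>

lemma cubic_growth_3_3:
  assumes "CARD('x::finite) = 3"
  obtains G :: "('x::finite, 'k::field) free_alg" and \<beta> where
    "G \<in> potentials_from 3" "\<And>j. growth G j \<le> \<beta> j"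
    "\<And>F j. F \<in> (potentials_from 3 :: ('x::finite, 'k::field) free_alg set) \<Longrightarrow> \<beta> j \<le> growth_completion F j"
    "\<And>j. j ^ 3 \<le> 12 * \<beta> j" "\<And>j. j \<ge> 1 \<Longrightarrow> \<beta> j \<le> 10 * j ^ 3"
proof -
  obtain x y z :: 'x where U: "UNIV = {x, y, z}" and xyz: "x \<noteq> y" "x \<noteq> z" "y \<noteq> z"
    using assms card_3_iff[of "UNIV :: 'x set"] by auto
  interpret reference_potential
    "mon [x, y, z] + mon [y, z, x] + mon [z, x, y] - (mon [x, z, y] + mon [z, y, x] + mon [y, x, z]) :: ('x, 'k) free_alg"
    3 "{[y, x], [z, x], [z, y]}" x "\<lambda>c. if c = x then 0 else if c = y then 1 else 2"
    "\<lambda>j. card {w \<in> avoiding {[y, x], [z, x], [z, y]}. length w \<le> j}"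
    by (rule reference_potential_3_3[OF xyz U])
  note cf = beta3_closed_form[OF xyz U]
  show ?thesis
  proof (rule that[OF G growth_reference_le beta_le_growth_completion])
    fix j :: nat
    have "j ^ 3 \<le> (j + 1) * (j + 2) * (j + 3)" by (simp add: power3_eq_cube algebra_simps)
    then show "j ^ 3 \<le> 12 * card {w \<in> avoiding {[y, x], [z, x], [z, y]}. length w \<le> j}"
      using cf[of j] by linarith
    assume "j \<ge> 1"
    then have "(j + 1) * (j + 2) * (j + 3) \<le> (2 * j) * (3 * j) * (4 * j)"
      by (intro mult_mono) auto
    then show "card {w \<in> avoiding {[y, x], [z, x], [z, y]}. length w \<le> j} \<le> 10 * j ^ 3"
      using cf[of j] by (simp add: power3_eq_cube)
  qed
qed

lemma cubic_growth_2_4: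
  assumes "CARD('x::finite) = 2"
  obtains G :: "('x::finite, 'k::field) free_alg" and \<beta> where
    "G \<in> potentials_from 4" "\<And>j. growth G j \<le> \<beta> j"
    "\<And>F j. F \<in> (potentials_from 4 :: ('x::finite, 'k::field) free_alg set) \<Longrightarrow> \<beta> j \<le> growth_completion F j"
    "\<And>j. j ^ 3 \<le> 12 * \<beta> j" "\<And>j. j \<ge> 1 \<Longrightarrow> \<beta> j \<le> 10 * j ^ 3"
proof -
  obtain x y :: 'x where U: "UNIV = {x, y}" and xy: "x \<noteq> y"
    using assms card_2_iff[of "UNIV :: 'x set"] by auto
  let ?Fb = "{y # replicate (Suc 1) x, y # y # replicate 1 x}"
  define \<beta> where "\<beta> = (\<lambda>j. card {w \<in> avoiding ?Fb. length w \<le> j})"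
  interpret reference_potential
    "mon [x, x, y, y] + mon [x, y, y, x] + mon [y, y, x, x] + mon [y, x, x, y] :: ('x, 'k) free_alg"
    4 ?Fb x "\<lambda>c. if c = x then 0 else 1" \<beta>
    unfolding \<beta>_def by (rule reference_potential_2_4[OF xy U])
  have small: "\<beta> 0 = 1" "\<beta> (Suc 0) = 3" "\<beta> 2 = 7" "\<beta> 3 = 13"
    using beta2_0[OF xy U, of 1] beta2_small[OF xy U, of 1 0] beta2_small[OF xy U, of 1 1] beta2_rec_0[OF xy U, of 1]
    by (simp_all add: \<beta>_def numeral_eq_Suc)
  have rec': "\<beta> (m + 4) + 2 * \<beta> (Suc m) = 1 + 2 * \<beta> (m + 3) + \<beta> m" for m
    using beta2_rec_Suc[OF xy U, of 1 m] by (simp add: \<beta>_def numeral_eq_Suc)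
  \<comment> \<open>Since 1 - 2t + 2t^3 - t^4 = (1 - t)^3 (1 + t), the cumulative series is the
    inverse of (1 - t)^4 (1 + t). Adding neighbouring terms cancels the factor 1 + t and leaves the
    binomial coefficient of j + 4 over 3.\<close>
  have sum: "6 * (\<beta> (Suc j) + \<beta> j) = (j + 2) * (j + 3) * (j + 4)" for j
  proof (induction j rule: less_induct)
    case (less j)
    consider "j = 0" | "j = 1" | "j = 2" | m where "j = m + 3"
      using le_Suc_ex[of 3 j] by (cases "j < 3") (auto simp: add.commute less_Suc_eq numeral_3_eq_3)
    then show ?case
    proof cases
      case 4
      have "\<beta> (Suc (m + 3)) = \<beta> (m + 4)" by (simp add: numeral_eq_Suc)
      moreover have "\<beta> (Suc (m + 2)) = \<beta> (m + 3)" "\<beta> (Suc (m + 1)) = \<beta> (m + 2)" by (simp_all add: numeral_eq_Suc)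
      moreover have "6 * (\<beta> (Suc (m + 2)) + \<beta> (m + 2)) = (m + 2 + 2) * (m + 2 + 3) * (m + 2 + 4)"
        "6 * (\<beta> (Suc (m + 1)) + \<beta> (m + 1)) = (m + 1 + 2) * (m + 1 + 3) * (m + 1 + 4)"
        "6 * (\<beta> (Suc m) + \<beta> m) = (m + 2) * (m + 3) * (m + 4)"
        by (rule less.IH, simp add: 4)+
      ultimately show ?thesis
        using rec'[of m] unfolding 4 by (simp add: algebra_simps)
    qed (use small in \<open>auto simp: numeral_eq_Suc\<close>)
  qed
  have mono: "\<beta> j \<le> \<beta> (Suc j)" for j
    unfolding \<beta>_def by (rule card_mono) (auto intro: finite_subset[OF _ finite_words[of "Suc j"]])
  show ?thesis
  proof (rule that[OF G growth_reference_le beta_le_growth_completion])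
    show "j ^ 3 \<le> 12 * \<beta> j" for j
    proof (cases j)
      case (Suc i)
      have "j ^ 3 \<le> (i + 2) * (i + 3) * (i + 4)" by (simp add: Suc power3_eq_cube algebra_simps)
      also have "\<dots> = 6 * (\<beta> (Suc i) + \<beta> i)" by (simp only: sum)
      also have "\<dots> \<le> 12 * \<beta> j" using mono[of i] Suc by simp
      finally show ?thesis .
    qed simp
    show "\<beta> j \<le> 10 * j ^ 3" if "j \<ge> 1" for j
    proof -
      have "(j + 2) * (j + 3) * (j + 4) \<le> (3 * j) * (4 * j) * (5 * j)"
        using that by (intro mult_mono) auto
      then have "6 * \<beta> j \<le> 60 * j ^ 3" using sum[of j] by (simp add: power3_eq_cube)
      then show ?thesis by simp
    qed
  qed
qed

lemma exponential_growth_2_5: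
  assumes "CARD('x::finite) = 2" and F: "F \<in> (potentials_from 5 :: ('x, 'k::field) free_alg set)"
  shows "(3 / 2) ^ j \<le> real (growth_completion F j)"
proof -
  obtain x y :: 'x where U: "UNIV = {x, y}" and xy: "x \<noteq> y"
    using assms card_2_iff[of "UNIV :: 'x set"] by auto
  let ?Fb = "{y # replicate (Suc 2) x, y # y # replicate 2 x}"
  define \<beta> where "\<beta> = (\<lambda>j. card {w \<in> avoiding ?Fb. length w \<le> j})"
  interpret reference_potential
    "mon [x, x, x, y, y] + mon [x, x, y, y, x] + mon [x, y, y, x, x] + mon [y, y, x, x, x] + mon [y, x, x, x, y]
      :: ('x, 'k) free_alg"
    5 ?Fb x "\<lambda>c. if c = x then 0 else 1" \<beta>
    unfolding \<beta>_def by (rule reference_potential_2_5[OF xy U])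
  have small: "\<beta> 0 = 1" "\<beta> (Suc 0) = 3" "\<beta> 2 = 7" "\<beta> 3 = 15" "\<beta> 4 = 29"
    using beta2_0[OF xy U, of 2] beta2_small[OF xy U, of 2 0] beta2_small[OF xy U, of 2 1]
      beta2_small[OF xy U, of 2 2] beta2_rec_0[OF xy U, of 2]
    by (simp_all add: \<beta>_def numeral_eq_Suc)
  have rec': "\<beta> (m + 5) + 2 * \<beta> (Suc m) = 1 + 2 * \<beta> (m + 4) + \<beta> m" for m
    using beta2_rec_Suc[OF xy U, of 2 m] by (simp add: \<beta>_def numeral_eq_Suc)
  \<comment> \<open>The true growth rate is about 1.72, the largest root of s^4 - s^3 - s^2 - s + 1,
    and 3/2 is a convenient number below it. The upper ratio 3 serves the induction: it bounds the
    negative term \<open>2 * \<beta> (Suc m)\<close> of the recursion in terms of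
    \<open>\<beta> m\<close>.\<close>
  have ratio: "1 \<le> \<beta> j \<and> 3 * \<beta> j \<le> 2 * \<beta> (Suc j) \<and> \<beta> (Suc j) \<le> 3 * \<beta> j" for j
  proof (induction j rule: less_induct)
    case (less j)
    consider "j = 0" | "j = 1" | "j = 2" | "j = 3" | m where "j = m + 4"
      using le_Suc_ex[of 4 j] by (cases "j < 4") (auto simp: add.commute less_Suc_eq numeral_eq_Suc)
    then show ?case
    proof cases
      case 5
      have IH: "1 \<le> \<beta> i \<and> 3 * \<beta> i \<le> 2 * \<beta> (Suc i) \<and> \<beta> (Suc i) \<le> 3 * \<beta> i" if "i < m + 4" for i
        using less.IH that 5 by simp
      have "\<beta> (Suc (m + 4)) = \<beta> (m + 5)" "\<beta> (Suc (m + 3)) = \<beta> (m + 4)"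
        "\<beta> (Suc (m + 2)) = \<beta> (m + 3)" "\<beta> (Suc (m + 1)) = \<beta> (m + 2)" by (simp_all add: numeral_eq_Suc)
      then show ?thesis
        using rec'[of m] IH[of m] IH[of "m + 1"] IH[of "m + 2"] IH[of "m + 3"] unfolding 5 by simp
    qed (use small in \<open>auto simp: numeral_eq_Suc\<close>)
  qed
  have "(3 / 2) ^ j \<le> real (\<beta> j)"
  proof (induction j)
    case (Suc j)
    have "(3 / 2) ^ Suc j \<le> 3 / 2 * real (\<beta> j)" using Suc by simp
    also have "\<dots> \<le> real (\<beta> (Suc j))" using ratio[of j] by linarith
    finally show ?case .
  qed (simp add: small)
  also have "\<dots> \<le> real (growth_completion F j)" using beta_le_growth_completion[OF F] by simp
  finally show ?thesis .
qed

text \<open>Doubling reproduces itself. For k = 3, a_(m+1) >= 2 a_m gives n a_(m+1) - n a_m >= 2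
  a_(m+1) + (n - 4) a_m. For n = 3 and k = 4 the lag contains two doublings, so 3 a_m <=
  a_(m+2).\<close>

lemma exponential_growth_plain:
  assumes n: "CARD('x::finite) \<ge> 4 \<and> k = 3 \<or> CARD('x) = 3 \<and> k = 4"
    and F: "F \<in> (potentials_from k :: ('x, 'k::field) free_alg set)"
  shows "2 ^ j \<le> growth_completion F j"
proof -
  have k: "k \<ge> 2" using n by auto
  let ?r = "\<lambda>x. nc_deriv x F"
  interpret potential_relations ?r "k - 1" by (rule potential_relations_nc_deriv[OF F k])
  define a where "a j = int (words_le TYPE('x) j) - int (FA.dim (rel_trunc ?r j))" for j
  define n' where "n' = int CARD('x)"
  have a0: "a j \<ge> 0" for j
    using dim_le_words_le[OF rel_trunc_low, of ?r j] by (simp add: a_def)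
  have rec: "a (Suc m + (k - 2)) \<ge> 1 + n' * a (m + (k - 2)) - n' * a m" for m
  proof -
    have j: "Suc m + (k - 2) = m + (k - 1)" using k by simp
    have "int (FA.dim (rel_trunc ?r (Suc m + (k - 2)))) + n' * int (FA.dim (rel_trunc ?r m)) \<le>
        n' * int (FA.dim (rel_trunc ?r (m + (k - 2)))) + n' * int (words_le TYPE('x) m)"
      using dim_rel_trunc_le_complement[OF j] unfolding n'_def
      by (simp flip: of_nat_mult of_nat_add)
    moreover have "int (words_le TYPE('x) (Suc m + (k - 2))) = 1 + n' * int (words_le TYPE('x) (m + (k - 2)))"
      by (simp add: words_le_Suc n'_def)
    ultimately show ?thesis by (simp add: a_def right_diff_distrib)
  qed
  have dim0: "FA.dim (rel_trunc ?r j) = 0" if "j < k - 1" for j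
    using FA.dim_le_card[of "{0}" "{}"] by (simp add: rel_trunc_eq_0[OF that])
  have small: "a 0 = 1" "a 1 = 1 + n'" "k = 4 \<Longrightarrow> a 2 = 1 + n' * (1 + n')"
    using n dim0 by (auto simp: a_def n'_def words_le_0 words_le_Suc numeral_2_eq_2 algebra_simps)
  have ratio: "2 * a j \<le> a (Suc j)" for j
  proof (cases "k = 3")
    case True
    then have n4: "n' \<ge> 4" using n by (auto simp: n'_def)
    show ?thesis
    proof (induction j)
      case 0
      then show ?case using small(1,2) n4 by simp
    next
      case (Suc m)
      have "0 \<le> (n' - 2) * (a (Suc m) - 2 * a m)" "0 \<le> (n' - 4) * a m"
        using Suc n4 a0[of m] by auto
      then show ?case using rec[of m] True by (simp add: algebra_simps)
    qed
  next
    case False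
    then have n3: "n' = 3" and k4: "k = 4" using n by (auto simp: n'_def)
    have rec4: "a (Suc (Suc (Suc m))) \<ge> 1 + 3 * a (Suc (Suc m)) - 3 * a m" for m
      using rec[of m] by (simp add: k4 n3 numeral_2_eq_2)
    have "2 * a j \<le> a (Suc j) \<and> 2 * a (Suc j) \<le> a (Suc (Suc j))"
    proof (induction j)
      case 0
      then show ?case using small k4 n3 by (simp add: numeral_2_eq_2)
    next
      case (Suc m)
      then show ?case using rec4[of m] a0[of m] by linarith
    qed
    then show ?thesis ..
  qed
  have "2 ^ j \<le> a j"
  proof (induction j)
    case (Suc j)
    then show ?case using ratio[of j] by simp
  qed (simp add: small)
  then have "int (2 ^ j) + int (FA.dim (rel_trunc ?r j)) \<le> int (words_le TYPE('x) j)"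
    by (simp add: a_def)
  then have "2 ^ j + FA.dim (rel_trunc ?r j) \<le> words_le TYPE('x) j" by linarith
  then show ?thesis using words_le_growth_completion[OF F k, of j] by linarith
qed

text \<open>Raising k only shrinks the set of potentials, so it suffices to treat k = 5 for n = 2, k
  = 4 for n = 3 and k = 3 for n >= 4. The rate 3/2 comes from the first of these.\<close>

lemma exponential_growth:
  assumes n: "CARD('x::finite) \<ge> 2" "k \<ge> 3" "(CARD('x), k) \<notin> {(2, 3), (2, 4), (3, 3)}"
    and F: "F \<in> (potentials_from k :: ('x, 'k::field) free_alg set)"
  shows "(3 / 2) ^ j \<le> real (growth_completion F j)"
proof -
  consider "CARD('x) = 2" "k \<ge> 5" | "CARD('x) = 3" "k \<ge> 4" | "CARD('x) \<ge> 4" using n by fastforce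
  then show ?thesis
  proof cases
    case 1
    then show ?thesis using exponential_growth_2_5 F potentials_from_mono by blast
  next
    case 2
    then have "2 ^ j \<le> growth_completion F j"
      using exponential_growth_plain[of 4 F] F potentials_from_mono by blast
    then have "(2 :: real) ^ j \<le> real (growth_completion F j)" by (simp flip: of_nat_power_le_of_nat_cancel_iff)
    then show ?thesis using power_mono[of "3 / 2" "2 :: real" j] by linarith
  next
    case 3
    then have "2 ^ j \<le> growth_completion F j"
      using exponential_growth_plain[of 3 F] F potentials_from_mono n(2) by blast
    then have "(2 :: real) ^ j \<le> real (growth_completion F j)" by (simp flip: of_nat_power_le_of_nat_cancel_iff)
    then show ?thesis using power_mono[of "3 / 2" "2 :: real" j] by linarith
  qed
qed

lemma at_least_cubicI:
  assumes "\<And>j. j ^ 3 \<le> 12 * g j"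
  shows "at_least_cubic g"
  unfolding at_least_cubic_def
proof (intro exI conjI always_eventually allI)
  fix j
  have "real (j ^ 3) \<le> real (12 * g j)" using assms of_nat_le_iff by blast
  then show "1 / 12 * real j ^ 3 \<le> real (g j)" by simp
qed simp

lemma cubicI:
  assumes "\<And>j. j ^ 3 \<le> 12 * g j" "\<And>j. j \<ge> 1 \<Longrightarrow> g j \<le> 10 * j ^ 3"
  shows "cubic g"
  unfolding cubic_def
proof (intro conjI at_least_cubicI assms exI)
  show "\<forall>\<^sub>F j in sequentially. real (g j) \<le> 10 * real j ^ 3"
    using eventually_ge_at_top[of 1]
  proof eventually_elim
    case (elim j)
    then have "real (g j) \<le> real (10 * j ^ 3)" using assms(2) of_nat_le_iff by blast
    then show ?case by simp
  qed
qed

lemma exponentialI: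
  assumes "\<And>j. (3 / 2) ^ j \<le> real (g j)"
  shows "exponential g"
  unfolding exponential_def
  by (rule exI[of _ 1], rule exI[of _ "3 / 2"]) (simp add: assms)

theorem theorem1p1:
  fixes n k :: nat
  assumes "n = CARD('x)" and "n \<ge> 2" and "k \<ge> 3" and "(n, k) \<noteq> (2, 3)"
  shows "(\<forall>F \<in> (potentials_from k :: ('x::finite, 'k::field) free_alg set).
            infinite_dim_pot_alg_completion F \<and> infinite_dim_pot_alg F)
       \<and> ((n, k) = (2, 4) \<or> (n, k) = (3, 3) \<longrightarrow>
            (\<forall>F \<in> (potentials_from k :: ('x, 'k) free_alg set).
               at_least_cubic (growth_completion F) \<and> at_least_cubic (growth F))
          \<and> (\<exists>F \<in> (potentials_from k :: ('x, 'k) free_alg set).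
               cubic (growth_completion F) \<and> cubic (growth F)))
       \<and> ((n, k) \<noteq> (2, 4) \<and> (n, k) \<noteq> (3, 3) \<longrightarrow>
            (\<forall>F \<in> (potentials_from k :: ('x, 'k) free_alg set).
               exponential (growth_completion F) \<and> exponential (growth F)))"
proof -
  have k2: "k \<ge> 2" using assms(3) by simp
  \<comment> \<open>Kept generic in the reference potential and its counting function, so that both
    cubic pairs are instances.\<close>
  have cubic_case: "(\<forall>F\<in>(potentials_from k :: ('x, 'k) free_alg set).
      (infinite_dim_pot_alg_completion F \<and> infinite_dim_pot_alg F) \<and>
      at_least_cubic (growth_completion F) \<and> at_least_cubic (growth F)) \<and>
      (\<exists>F\<in>(potentials_from k :: ('x, 'k) free_alg set). cubic (growth_completion F) \<and> cubic (growth F))"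
    if G: "G \<in> potentials_from k" "\<And>j. growth G j \<le> \<beta> j"
      and below: "\<And>F j. F \<in> (potentials_from k :: ('x, 'k) free_alg set) \<Longrightarrow> \<beta> j \<le> growth_completion F j"
      and \<beta>: "\<And>j. j ^ 3 \<le> 12 * \<beta> j" "\<And>j. j \<ge> 1 \<Longrightarrow> \<beta> j \<le> 10 * j ^ 3"
    for G :: "('x, 'k) free_alg" and \<beta>
  proof -
    have lower: "j ^ 3 \<le> 12 * growth_completion F j" "j ^ 3 \<le> 12 * growth F j"
      if F: "F \<in> (potentials_from k :: ('x, 'k) free_alg set)" for F j
      using \<beta>(1)[of j] below[OF F, of j] growth_completion_le_growth[OF F k2, of j] by linarith+
    have inf: "infinite_dim_pot_alg_completion F \<and> infinite_dim_pot_alg F"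
      if F: "F \<in> (potentials_from k :: ('x, 'k) free_alg set)" for F
    proof (intro conjI infinite_dim_completionI[OF F k2])
      fix C :: nat
      \<comment> \<open>Chosen so that \<open>j \<le> j ^ 3\<close> and the cubic lower bound give
        at least \<open>C + 1\<close>.\<close>
      define j where "j = 12 * (C + 1)"
      have "j \<le> j ^ 3" by (rule self_le_power) (auto simp: j_def)
      then have "j \<le> 12 * growth_completion F j" using lower(1)[OF F] by (rule order_trans)
      then have "C < growth_completion F j" by (simp add: j_def)
      then show "\<exists>j. C < growth_completion F j" "\<exists>j. C < growth_completion F j" by blast+
    qed
    have "growth G j \<le> 10 * j ^ 3" "growth_completion G j \<le> 10 * j ^ 3" if "j \<ge> 1" for j
      using G(2)[of j] \<beta>(2)[OF that] growth_completion_le_growth[OF G(1) k2, of j] by linarith+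
    then have "cubic (growth_completion G)" "cubic (growth G)"
      by (intro cubicI lower[OF G(1)]; blast)+
    then show ?thesis using inf lower G(1) by (blast intro: at_least_cubicI)
  qed
  consider "(n, k) = (2, 4)" | "(n, k) = (3, 3)" | "(n, k) \<noteq> (2, 4)" "(n, k) \<noteq> (3, 3)" by blast
  then show ?thesis
  proof cases
    case 1
    then have c: "CARD('x) = 2" and k: "k = 4" using assms(1) by auto
    show ?thesis
    proof (rule cubic_growth_2_4[OF c])
      fix G :: "('x, 'k) free_alg" and \<beta>
      assume "G \<in> potentials_from 4" "\<And>j. growth G j \<le> \<beta> j"
        "\<And>F j. F \<in> (potentials_from 4 :: ('x, 'k) free_alg set) \<Longrightarrow> \<beta> j \<le> growth_completion F j"
        "\<And>j. j ^ 3 \<le> 12 * \<beta> j" "\<And>j. j \<ge> 1 \<Longrightarrow> \<beta> j \<le> 10 * j ^ 3"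
      from cubic_case[unfolded k, OF this] show ?thesis unfolding k using 1 by blast
    qed
  next
    case 2
    then have c: "CARD('x) = 3" and k: "k = 3" using assms(1) by auto
    show ?thesis
    proof (rule cubic_growth_3_3[OF c])
      fix G :: "('x, 'k) free_alg" and \<beta>
      assume "G \<in> potentials_from 3" "\<And>j. growth G j \<le> \<beta> j"
        "\<And>F j. F \<in> (potentials_from 3 :: ('x, 'k) free_alg set) \<Longrightarrow> \<beta> j \<le> growth_completion F j"
        "\<And>j. j ^ 3 \<le> 12 * \<beta> j" "\<And>j. j \<ge> 1 \<Longrightarrow> \<beta> j \<le> 10 * j ^ 3"
      from cubic_case[unfolded k, OF this] show ?thesis unfolding k using 2 by blast
    qed
  next
    case 3
    then have not_cubic: "CARD('x) \<ge> 2" "k \<ge> 3" "(CARD('x), k) \<notin> {(2, 3), (2, 4), (3, 3)}"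
      using assms by auto
    have lower: "(3 / 2) ^ j \<le> real (growth_completion F j)" "(3 / 2) ^ j \<le> real (growth F j)"
      if F: "F \<in> (potentials_from k :: ('x, 'k) free_alg set)" for F j
      using exponential_growth[OF not_cubic F, of j] growth_completion_le_growth[OF F k2, of j] by linarith+
    have inf: "infinite_dim_pot_alg_completion F \<and> infinite_dim_pot_alg F"
      if F: "F \<in> (potentials_from k :: ('x, 'k) free_alg set)" for F
    proof (intro conjI infinite_dim_completionI[OF F k2])
      fix C :: nat
      obtain j where "real C < (3 / 2) ^ j" using real_arch_pow[of "3 / 2" "real C"] by auto
      then have "C < growth_completion F j" using lower(1)[OF F, of j] by linarith
      then show "\<exists>j. C < growth_completion F j" "\<exists>j. C < growth_completion F j" by blast+
    qed
    have "exponential (growth_completion F) \<and> exponential (growth F)"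
      if F: "F \<in> (potentials_from k :: ('x, 'k) free_alg set)" for F
      using lower[OF F] by (blast intro: exponentialI)
    then show ?thesis using inf 3 by blast
  qed
qed

end
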